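(* For $0<\nu<\infty$ let $X_\nu=(X_\nu(t))_{t\in\mathbb{R}}$ be a centered stationary Gaussian process with continuous sample paths and spectral measure $F_\nu(du)=e^{-|u|^\nu}\,du$ on $\mathbb{R}$. For $0<c\le1$ define the rescaled process $X_\nu^c(t)=X_\nu(t/c)$, and let $$\varphi(X_\nu^c,r)=-\log\mathbb{P}\Big(\sup_{t\in[0,1]}|X_\nu^c(t)|\le r\Big),\qquad r>0.$$ Then for all $0<c\le 1$, as $r\to0$, $$\varphi(X_\nu^c,r)\preceq\frac1c\,\frac{|\log r|^2}{\log|\log r|}\qquad\text{for every }\nu>1,$$ and $$\varphi(X_\nu^c,r)\preceq\frac1c\,|\log r|^{1+\frac1\nu}\qquad\text{for every }0<\nu\le1.$$
   Context: The process is real-valued. A centered stationary Gaussian process $X$ has (symmetric, finite) spectral measure $F$ if $\mathbb{E}\,X(s)X(t)=\int_{\mathbb{R}}e^{i(s-t)u}\,F(du)$ for all $s,t\in\mathbb{R}$. For functions of $r\to 0$, $f\preceq g$ means $\limsup_{r\to0} f(r)/g(r)<\infty$. *)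

theory Defs
  imports "HOL-Probability.Probability"
begin

(* Almost surely constant random variables count as Gaussian (variance zero). *)
definition gaussian_rv :: "'a measure \<Rightarrow> ('a \<Rightarrow> real) \<Rightarrow> bool" where
  "gaussian_rv M Y \<longleftrightarrow>
     Y \<in> borel_measurable M \<and>
     ((\<exists>\<mu>. AE \<omega> in M. Y \<omega> = \<mu>) \<or>
      (\<exists>\<mu> \<sigma>. \<sigma> > 0 \<and> distributed M lborel Y (\<lambda>x. ennreal (normal_density \<mu> \<sigma> x))))"

definition gaussian_process :: "'a measure \<Rightarrow> (real \<Rightarrow> 'a \<Rightarrow> real) \<Rightarrow> bool" where
  "gaussian_process M X \<longleftrightarrow>
     prob_space M \<and>
     (\<forall>J a. finite J \<longrightarrow> gaussian_rv M (\<lambda>\<omega>. \<Sum>t\<in>J. a t * X t \<omega>))"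

definition centered :: "'a measure \<Rightarrow> (real \<Rightarrow> 'a \<Rightarrow> real) \<Rightarrow> bool" where
  "centered M X \<longleftrightarrow> (\<forall>t. integrable M (X t) \<and> (LINT \<omega>|M. X t \<omega>) = 0)"

definition stationary :: "'a measure \<Rightarrow> (real \<Rightarrow> 'a \<Rightarrow> real) \<Rightarrow> bool" where
  "stationary M X \<longleftrightarrow>
     (\<forall>h J. finite J \<longrightarrow>
        distr M (\<Pi>\<^sub>M t\<in>J. borel) (\<lambda>\<omega>. \<lambda>t\<in>J. X (t + h) \<omega>) =
        distr M (\<Pi>\<^sub>M t\<in>J. borel) (\<lambda>\<omega>. \<lambda>t\<in>J. X t \<omega>))"

definition continuous_paths :: "'a measure \<Rightarrow> (real \<Rightarrow> 'a \<Rightarrow> real) \<Rightarrow> bool" where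
  "continuous_paths M X \<longleftrightarrow> (\<forall>\<omega>\<in>space M. continuous_on UNIV (\<lambda>t. X t \<omega>))"

definition has_spectral_measure ::
    "'a measure \<Rightarrow> (real \<Rightarrow> 'a \<Rightarrow> real) \<Rightarrow> real measure \<Rightarrow> bool" where
  "has_spectral_measure M X F \<longleftrightarrow>
     sets F = sets borel \<and> finite_measure F \<and> distr F borel uminus = F \<and>
     (\<forall>s t. complex_of_real (LINT \<omega>|M. X s \<omega> * X t \<omega>) = (CLINT u|F. iexp ((s - t) * u)))"

definition spectral_F :: "real \<Rightarrow> real measure" where
  "spectral_F \<nu> = density lborel (\<lambda>u. ennreal (exp (- (\<bar>u\<bar> powr \<nu>))))"

definition rescaled :: "(real \<Rightarrow> 'a \<Rightarrow> real) \<Rightarrow> real \<Rightarrow> real \<Rightarrow> 'a \<Rightarrow> real" where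
  "rescaled X c t = X (t / c)"

(* The value is infinity at probability zero, since ln 0 = 0 would give a spurious 0.  The real
   supremum is used only for processes with continuous paths, which are bounded on {0..1}. *)
definition small_dev :: "'a measure \<Rightarrow> (real \<Rightarrow> 'a \<Rightarrow> real) \<Rightarrow> real \<Rightarrow> ereal" where
  "small_dev M X r =
     (let p = measure M {\<omega> \<in> space M. (SUP t\<in>{0..1}. \<bar>X t \<omega>\<bar>) \<le> r}
      in if p = 0 then \<infinity> else ereal (- ln p))"

definition preceq0 :: "(real \<Rightarrow> ereal) \<Rightarrow> (real \<Rightarrow> real) \<Rightarrow> bool" where
  "preceq0 f g \<longleftrightarrow> Limsup (at_right 0) (\<lambda>r. f r / ereal (g r)) < \<infinity>"

end

theory Submission
  imports Defs "HOL-Computational_Algebra.Polynomial" "HOL-Real_Asymp.Real_Asymp"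
begin

text \<open>
  On \<open>[0, 1 / c]\<close> the process is interpolated by polynomials of degree below \<open>N\<close> on each of \<open>K\<close>
  subintervals. The moments of \<open>F\<^sub>\<nu>\<close> show that the interpolation error has variance
  \<open>O(r\<^sup>8)\<close> as soon as \<open>N\<close> is of order \<open>|log r| / log |log r|\<close> with \<open>K = 1\<close> (for \<open>\<nu> > 1\<close>), or of order
  \<open>|log r|\<close> with \<open>K\<close> of order \<open>N\<close> to the power \<open>1 / \<nu> - 1\<close> (for \<open>\<nu> \<le> 1\<close>). The \<open>N K\<close> node values are all
  smaller than a power of \<open>r\<close> with probability at least \<open>exp (- C N K |log r|)\<close>, whereas an error of
  size \<open>r\<close> is superexponentially unlikely, so a union bound suffices and no correlation inequality is
  needed. Only one-dimensional Gaussian laws enter: the bound for the node values comes from writing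
  \<open>exp (- y\<^sup>2 / 2)\<close> as a characteristic function.
\<close>

section \<open>One-dimensional Gaussian estimates\<close>

text \<open>The exponents come from the sum of absolute interpolation weights for equispaced nodes,
  which is at most \<open>6 ^ N\<close>. Since \<open>N\<close> stays below
  \<open>5 * (- ln r)\<close>, this is a power of \<open>r\<close>: node values of size about
  \<open>r ^ 11\<close> keep the interpolant below \<open>r\<close>, and each node costs a factor
  \<open>r ^ 13\<close> of probability. Nearby nodes are almost linearly dependent, so a bound
  through the joint density is hopeless; the functional \<open>exp (- y\<^sup>2 / 2)\<close> needs
  nothing but upper bounds on variances. By the moment bound the standard deviation of the error is
  at most a constant times the \<open>N\<close>-th power of
  \<open>D * N powr (1 / \<nu> - 1) / K\<close>. The sign of \<open>1 / \<nu> - 1\<close> separates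
  the regimes: for \<nu> > 1 this base decays by itself and \<open>N * ln N\<close> of order
  \<open>- ln r\<close> suffices; for \<nu> \<le> 1 the number \<open>K\<close> of subintervals has
  to push it below \<open>1 / e\<close>. The union bound works because \<open>N * K\<close> is at
  most \<open>r powr (-1/2)\<close>, so the main term is at least
  \<open>exp (- 14 * r powr (-1/2) * (- ln r))\<close>, whereas the error terms are of type
  \<open>exp (- const / r\<^sup>2)\<close> or smaller.\<close>

lemma std_normal_sq:
  "integrable std_normal_distribution (\<lambda>a. a\<^sup>2)" "(LINT a|std_normal_distribution. a\<^sup>2) = 1"
  using std_normal_distribution_even_moments[of 1] by simp_all

text \<open>The shift \<open>z\<close> is the phase inherited from variables that have already been
  removed from a Gaussian functional. No sine term appears because the characteristic function of
  the standard normal law is real.\<close>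

lemma integral_std_normal_cos:
  "(LINT a|std_normal_distribution. cos (z + a * y)) = cos z * exp (- y\<^sup>2 / 2)"
proof -
  interpret N: real_distribution std_normal_distribution by (rule real_dist_normal_dist)
  have *: "integrable std_normal_distribution (\<lambda>a. iexp z * iexp (y * a))"
    by (rule N.integrable_const_bound[where B = 1]) (auto simp: norm_mult)
  have "(LINT a|std_normal_distribution. cos (z + a * y))
      = (LINT a|std_normal_distribution. Re (iexp z * iexp (y * a)))"
    by (intro Bochner_Integration.integral_cong refl)
       (simp add: exp_add[symmetric] Re_exp mult.commute)
  also have "\<dots> = Re (CLINT a|std_normal_distribution. iexp z * iexp (y * a))"
    by (rule integral_Re[OF *])
  also have "(CLINT a|std_normal_distribution. iexp z * iexp (y * a))
      = iexp z * char std_normal_distribution y"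
    unfolding char_def by simp
  also have "Re \<dots> = cos z * exp (- y\<^sup>2 / 2)"
    by (simp add: char_std_normal_distribution Re_exp del: of_real_exp)
  finally show ?thesis .
qed

text \<open>Half of the exponent \<open>a\<^sup>2 / 2\<close> is bounded by its value at
  \<open>x\<close>; the other half is, up to the factor \<open>sqrt 2\<close>, the density of the
  normal law with variance 2.\<close>

lemma std_normal_tail:
  fixes x :: real
  assumes "0 \<le> x"
  shows "measure std_normal_distribution {a. x < \<bar>a\<bar>} \<le> 2 * exp (- x\<^sup>2 / 4)"
proof -
  interpret N: real_distribution std_normal_distribution by (rule real_dist_normal_dist)
  have dom: "std_normal_density a * indicator {a. x < \<bar>a\<bar>} a
      \<le> sqrt 2 * exp (- x\<^sup>2 / 4) * normal_density 0 (sqrt 2) a" for a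
  proof (cases "x < \<bar>a\<bar>")
    case True
    then have "x\<^sup>2 \<le> a\<^sup>2" using assms by (metis abs_le_square_iff abs_of_nonneg less_imp_le)
    then have "exp (- a\<^sup>2 / 2) \<le> exp (- x\<^sup>2 / 4) * exp (- a\<^sup>2 / 4)"
      by (simp add: exp_add[symmetric])
    moreover have two: "sqrt 2 * (sqrt 2 * y) = 2 * y" for y :: real
      by (simp add: mult.assoc[symmetric])
    ultimately show ?thesis
      using True by (simp add: normal_density_def real_sqrt_mult field_simps two)
  qed simp
  have "measure std_normal_distribution {a. x < \<bar>a\<bar>}
      = (LINT a|lborel. std_normal_density a * indicator {a. x < \<bar>a\<bar>} a)"
  proof -
    have "measure std_normal_distribution {a. x < \<bar>a\<bar>}
        = (LINT a|std_normal_distribution. indicator {a. x < \<bar>a\<bar>} a)" by simp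
    also have "\<dots> = (LINT a|lborel. std_normal_density a * indicator {a. x < \<bar>a\<bar>} a)"
      by (subst integral_real_density) auto
    finally show ?thesis .
  qed
  also have "\<dots> \<le> (LINT a|lborel. sqrt 2 * exp (- x\<^sup>2 / 4) * normal_density 0 (sqrt 2) a)"
  proof (rule integral_mono[OF _ _ dom])
    show "integrable lborel (\<lambda>a. std_normal_density a * indicator {a. x < \<bar>a\<bar>} a)"
      by (rule Bochner_Integration.integrable_bound[OF integrable_normal_density[of 1 0]])
         (auto simp: indicator_def)
  qed auto
  also have "\<dots> = sqrt 2 * exp (- x\<^sup>2 / 4)" by simp
  also have "\<dots> \<le> 2 * exp (- x\<^sup>2 / 4)"
    by (intro mult_right_mono) (auto intro: real_le_lsqrt)
  finally show ?thesis .
qed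

text \<open>On [-1, 1] the density is at least \<open>1 / 3 * (1 / 2)\<close>, and the interval has
  length \<open>2 * b\<close>.\<close>

lemma std_normal_near_zero:
  fixes b :: real
  assumes "0 \<le> b" "b \<le> 1"
  shows "b / 3 \<le> measure std_normal_distribution {a. \<bar>a\<bar> \<le> b}"
proof -
  interpret N: real_distribution std_normal_distribution by (rule real_dist_normal_dist)
  have "measure std_normal_distribution {a. \<bar>a\<bar> \<le> b}
      = (LINT a|lborel. std_normal_density a * indicator {a. \<bar>a\<bar> \<le> b} a)"
  proof -
    have "measure std_normal_distribution {a. \<bar>a\<bar> \<le> b}
        = (LINT a|std_normal_distribution. indicator {a. \<bar>a\<bar> \<le> b} a)" by simp
    also have "\<dots> = (LINT a|lborel. std_normal_density a * indicator {a. \<bar>a\<bar> \<le> b} a)"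
      by (subst integral_real_density) auto
    finally show ?thesis .
  qed
  moreover have "(LINT a|lborel. 1 / 6 * indicator {-b..b} a) \<le> \<dots>"
  proof (rule integral_mono)
    show "integrable lborel (\<lambda>a. std_normal_density a * indicator {a. \<bar>a\<bar> \<le> b} a)"
      by (rule Bochner_Integration.integrable_bound[OF integrable_normal_density[of 1 0]])
         (auto simp: indicator_def)
    fix a :: real
    show "1 / 6 * indicator {-b..b} a \<le> std_normal_density a * indicator {a. \<bar>a\<bar> \<le> b} a"
    proof (cases "\<bar>a\<bar> \<le> b")
      case True
      then have "a\<^sup>2 \<le> 1" using assms by (simp add: abs_square_le_1)
      then have "exp (- 1 / 2) \<le> exp (- a\<^sup>2 / 2)" by simp
      moreover have "1 / 2 \<le> exp (- 1 / 2 :: real)" using exp_ge_add_one_self[of "- 1 / 2 :: real"] by simp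
      ultimately have e: "1 / 2 \<le> exp (- a\<^sup>2 / 2)" by linarith
      have "sqrt (2 * pi) \<le> 3" using pi_less_4 by (intro real_le_lsqrt) auto
      then have "1 / 3 \<le> 1 / sqrt (2 * pi)" by (intro divide_left_mono) auto
      then have "1 / 3 * (1 / 2) \<le> 1 / sqrt (2 * pi) * exp (- a\<^sup>2 / 2)"
        using e by (intro mult_mono) auto
      moreover have "indicator {-b..b} a = (1::real)" using True by (auto simp: indicator_def)
      ultimately show ?thesis using True by (simp add: std_normal_density_def)
    qed (auto simp: indicator_def)
    show "integrable lborel (\<lambda>a. 1 / 6 * indicator {-b..b} a :: real)"
      by (intro integrable_mult_right integrable_real_indicator) (auto simp: emeasure_lborel_Icc_eq)
  qed
  ultimately show ?thesis using assms by simp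
qed

text \<open>A set of jointly centered Gaussian random variables, seen only through its
  one-dimensional marginals.\<close>
locale gaussian_space = prob_space M for M :: "'a measure" +
  fixes L :: "('a \<Rightarrow> real) set"
  assumes gaussian: "Z \<in> L \<Longrightarrow> gaussian_rv M Z"
    and mean_zero: "Z \<in> L \<Longrightarrow> expectation Z = 0"
    and closed_add: "Z \<in> L \<Longrightarrow> W \<in> L \<Longrightarrow> (\<lambda>\<omega>. Z \<omega> + W \<omega>) \<in> L"
    and closed_scale: "Z \<in> L \<Longrightarrow> (\<lambda>\<omega>. a * Z \<omega>) \<in> L"
begin

lemma measurable_L: "Z \<in> L \<Longrightarrow> Z \<in> borel_measurable M"
  using gaussian unfolding gaussian_rv_def by blast

text \<open>Allowing \<open>\<sigma> = 0\<close> merges the degenerate and the density case of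
  \<open>gaussian_rv\<close>, so that every later fact about one variable becomes an integral
  against the standard normal law.\<close>

lemma distr_as_std_normal:
  assumes "Z \<in> L"
  obtains \<sigma> where "\<sigma> \<ge> 0" "distr M borel Z = distr std_normal_distribution borel (\<lambda>a. \<sigma> * a)"
proof -
  interpret N: real_distribution std_normal_distribution by (rule real_dist_normal_dist)
  note [measurable] = measurable_L[OF assms]
  consider (const) \<mu> where "AE \<omega> in M. Z \<omega> = \<mu>"
    | (normal) \<mu> \<sigma> where "\<sigma> > 0" "distributed M lborel Z (\<lambda>x. ennreal (normal_density \<mu> \<sigma> x))"
    using gaussian[OF assms] unfolding gaussian_rv_def by blast
  then show thesis
  proof cases
    case const
    then have "expectation Z = expectation (\<lambda>_. \<mu>)" by (intro integral_cong_AE) auto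
    then have "\<mu> = 0" using mean_zero[OF assms] by (simp add: prob_space)
    then have "distr M borel Z = distr M borel (\<lambda>_. 0)"
      using const by (intro distr_cong_AE) auto
    also have "\<dots> = distr std_normal_distribution borel (\<lambda>a. 0 * a)"
      by (simp add: distr_const N.distr_const)
    finally show thesis using that[of 0] by simp
  next
    case normal
    have "expectation Z = \<mu>"
      using distributed_integral[OF normal(2), of "\<lambda>x. x"] integral_normal_moment_nz_1[OF normal(1)]
      by simp
    then have "\<mu> = 0" using mean_zero[OF assms] by simp
    then have "distributed M lborel (\<lambda>\<omega>. Z \<omega> / \<sigma>) std_normal_density"
      using normal normal_standard_normal_convert[OF normal(1), of Z \<mu>] by simp
    then have "distr M lborel (\<lambda>\<omega>. Z \<omega> / \<sigma>) = std_normal_distribution"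
      by (rule distributed_distr_eq_density)
    then have "distr std_normal_distribution borel (\<lambda>a. \<sigma> * a)
        = distr (distr M lborel (\<lambda>\<omega>. Z \<omega> / \<sigma>)) borel (\<lambda>a. \<sigma> * a)" by simp
    also have "\<dots> = distr M borel Z"
      using normal(1) by (subst distr_distr) (auto simp: o_def)
    finally show thesis using that[of \<sigma>] normal(1) by simp
  qed
qed

lemma
  assumes "Z \<in> L"
  shows square_integrable: "integrable M (\<lambda>\<omega>. (Z \<omega>)\<^sup>2)"
    and expectation_cos: "expectation (\<lambda>\<omega>. cos (Z \<omega>)) = exp (- expectation (\<lambda>\<omega>. (Z \<omega>)\<^sup>2) / 2)"
    and tail_bound: "\<And>x s. 0 \<le> x \<Longrightarrow> 0 < s \<Longrightarrow> expectation (\<lambda>\<omega>. (Z \<omega>)\<^sup>2) \<le> s\<^sup>2 \<Longrightarrow>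
      prob {\<omega>\<in>space M. x < \<bar>Z \<omega>\<bar>} \<le> 2 * exp (- (x / s)\<^sup>2 / 4)"
proof -
  interpret N: real_distribution std_normal_distribution by (rule real_dist_normal_dist)
  note [measurable] = measurable_L[OF assms]
  obtain \<sigma> where \<sigma>: "\<sigma> \<ge> 0" "distr M borel Z = distr std_normal_distribution borel (\<lambda>a. \<sigma> * a)"
    using distr_as_std_normal[OF assms] .
  have int: "expectation (\<lambda>\<omega>. g (Z \<omega>)) = (LINT a|std_normal_distribution. g (\<sigma> * a))"
    if "g \<in> borel_measurable borel" for g :: "real \<Rightarrow> real"
    using integral_distr[of Z M borel g] integral_distr[of "\<lambda>a. \<sigma> * a" std_normal_distribution borel g]
      that \<sigma>(2) by simp
  have "integrable std_normal_distribution (\<lambda>a. (\<sigma> * a)\<^sup>2)"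
    by (simp add: power_mult_distrib std_normal_sq)
  then have "integrable (distr std_normal_distribution borel (\<lambda>a. \<sigma> * a)) (\<lambda>x. x\<^sup>2)"
    by (subst integrable_distr_eq) auto
  then have "integrable (distr M borel Z) (\<lambda>x. x\<^sup>2)" using \<sigma>(2) by simp
  then show "integrable M (\<lambda>\<omega>. (Z \<omega>)\<^sup>2)" by (subst (asm) integrable_distr_eq) auto
  have var: "expectation (\<lambda>\<omega>. (Z \<omega>)\<^sup>2) = \<sigma>\<^sup>2"
    by (subst int) (auto simp: power_mult_distrib std_normal_sq)
  show "expectation (\<lambda>\<omega>. cos (Z \<omega>)) = exp (- expectation (\<lambda>\<omega>. (Z \<omega>)\<^sup>2) / 2)"
    using integral_std_normal_cos[of 0 \<sigma>] by (simp add: int var mult.commute)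
  fix x s :: real
  assume x: "0 \<le> x" and s: "0 < s" "expectation (\<lambda>\<omega>. (Z \<omega>)\<^sup>2) \<le> s\<^sup>2"
  then have "\<sigma> \<le> s" using var by (metis power2_le_imp_le less_imp_le)
  have "prob {\<omega>\<in>space M. x < \<bar>Z \<omega>\<bar>} = measure (distr M borel Z) {y. x < \<bar>y\<bar>}"
    by (subst measure_distr) (auto intro!: arg_cong[where f = prob])
  also have "\<dots> = measure std_normal_distribution {a. x < \<bar>\<sigma> * a\<bar>}"
    unfolding \<sigma>(2) by (subst measure_distr) (auto intro!: arg_cong[where f = "measure _"])
  also have "\<dots> \<le> measure std_normal_distribution {a. x / s < \<bar>a\<bar>}"
  proof (rule N.finite_measure_mono)
    show "{a. x < \<bar>\<sigma> * a\<bar>} \<subseteq> {a. x / s < \<bar>a\<bar>}"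
    proof safe
      fix a assume "x < \<bar>\<sigma> * a\<bar>"
      also have "\<dots> \<le> s * \<bar>a\<bar>" using \<open>\<sigma> \<le> s\<close> \<sigma>(1) by (simp add: abs_mult mult_right_mono)
      finally show "x / s < \<bar>a\<bar>" using s by (simp add: field_simps)
    qed
  qed auto
  also have "\<dots> \<le> 2 * exp (- (x / s)\<^sup>2 / 4)" using x s by (intro std_normal_tail) auto
  finally show "prob {\<omega>\<in>space M. x < \<bar>Z \<omega>\<bar>} \<le> 2 * exp (- (x / s)\<^sup>2 / 4)" .
qed

end

section \<open>Small balls of Gaussian vectors\<close>

context gaussian_space
begin

lemma zero_in_L: "Z \<in> L \<Longrightarrow> (\<lambda>\<omega>. 0) \<in> L"
  using closed_scale[of Z 0] by simp

lemma closed_sum: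
  assumes "finite I" "L \<noteq> {}" "\<And>i. i \<in> I \<Longrightarrow> Z i \<in> L"
  shows "(\<lambda>\<omega>. \<Sum>i\<in>I. Z i \<omega>) \<in> L"
  using assms(1,3)
proof (induction I)
  case empty
  then show ?case using zero_in_L assms(2) by auto
next
  case (insert i I)
  then show ?case using closed_add[of "Z i" "\<lambda>\<omega>. \<Sum>i\<in>I. Z i \<omega>"] by simp
qed

lemma closed_diff:
  assumes "Z \<in> L" "W \<in> L"
  shows "(\<lambda>\<omega>. Z \<omega> - W \<omega>) \<in> L"
  using closed_add[OF assms(1) closed_scale[OF assms(2), of "-1"]] by simp

lemma product_integrable:
  assumes "Z \<in> L" "W \<in> L"
  shows "integrable M (\<lambda>\<omega>. Z \<omega> * W \<omega>)"
proof (rule Bochner_Integration.integrable_bound)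
  note [measurable] = measurable_L[OF assms(1)] measurable_L[OF assms(2)]
  show "integrable M (\<lambda>\<omega>. (Z \<omega>)\<^sup>2 + (W \<omega>)\<^sup>2)" using assms by (auto intro: square_integrable)
  show "(\<lambda>\<omega>. Z \<omega> * W \<omega>) \<in> borel_measurable M" by measurable
  have "\<bar>a * b\<bar> \<le> a\<^sup>2 + b\<^sup>2" for a b :: real
  proof -
    have "0 \<le> (\<bar>a\<bar> - \<bar>b\<bar>)\<^sup>2" by simp
    also have "\<dots> = a\<^sup>2 + b\<^sup>2 - 2 * \<bar>a * b\<bar>" by (simp add: power2_diff abs_mult)
    finally show ?thesis by (smt (verit) abs_ge_zero)
  qed
  then show "AE \<omega> in M. norm (Z \<omega> * W \<omega>) \<le> norm ((Z \<omega>)\<^sup>2 + (W \<omega>)\<^sup>2)" by simp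
qed

text \<open>Minkowski's inequality from a pointwise weighted inequality; the weights
  \<open>1 + y / x\<close> and \<open>1 + x / y\<close> are those for which the two bounds add up to
  exactly \<open>(x + y)\<^sup>2\<close>.\<close>

lemma L2_triangle:
  fixes x y :: real
  assumes "Z \<in> L" "W \<in> L" "0 < x" "0 < y"
    and "expectation (\<lambda>\<omega>. (Z \<omega>)\<^sup>2) \<le> x\<^sup>2" "expectation (\<lambda>\<omega>. (W \<omega>)\<^sup>2) \<le> y\<^sup>2"
  shows "expectation (\<lambda>\<omega>. (Z \<omega> + W \<omega>)\<^sup>2) \<le> (x + y)\<^sup>2"
proof -
  have pw: "(a + b)\<^sup>2 \<le> (1 + y / x) * a\<^sup>2 + (1 + x / y) * b\<^sup>2" for a b :: real
  proof -
    have "0 \<le> (y * a - x * b)\<^sup>2 / (x * y)" using assms by simp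
    also have "\<dots> = (1 + y / x) * a\<^sup>2 + (1 + x / y) * b\<^sup>2 - (a + b)\<^sup>2"
      using assms by (simp add: field_simps power2_eq_square)
    finally show ?thesis by simp
  qed
  note int = square_integrable[OF assms(1)] square_integrable[OF assms(2)]
  have "expectation (\<lambda>\<omega>. (Z \<omega> + W \<omega>)\<^sup>2)
      \<le> expectation (\<lambda>\<omega>. (1 + y / x) * (Z \<omega>)\<^sup>2 + (1 + x / y) * (W \<omega>)\<^sup>2)"
    using int assms by (intro integral_mono pw square_integrable closed_add) auto
  also have "\<dots> = (1 + y / x) * expectation (\<lambda>\<omega>. (Z \<omega>)\<^sup>2) + (1 + x / y) * expectation (\<lambda>\<omega>. (W \<omega>)\<^sup>2)"
    using int by simp
  also have "\<dots> \<le> (1 + y / x) * x\<^sup>2 + (1 + x / y) * y\<^sup>2"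
    using assms by (intro add_mono mult_left_mono) auto
  also have "\<dots> = (x + y)\<^sup>2" using assms by (simp add: field_simps power2_eq_square)
  finally show ?thesis .
qed

text \<open>Writing \<open>exp (- y\<^sup>2 / 2)\<close> as the characteristic function of a standard normal variable
  reduces a Gaussian functional to characteristic functions of linear combinations; only small
  values of the auxiliary normal variable are retained.\<close>
lemma gaussian_functional_lower_bound:
  fixes s b x p :: real
  assumes "set Ys \<subseteq> L" "Z \<in> L"
    and "\<And>Y. Y \<in> set Ys \<Longrightarrow> expectation (\<lambda>\<omega>. (Y \<omega>)\<^sup>2) \<le> s\<^sup>2"
    and "0 < s" "0 < b" "0 < x" "expectation (\<lambda>\<omega>. (Z \<omega>)\<^sup>2) \<le> x\<^sup>2"
    and "0 \<le> p" "p \<le> measure std_normal_distribution {a. \<bar>a\<bar> \<le> b}"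
  shows "p ^ length Ys * exp (- (x + length Ys * (b * s))\<^sup>2 / 2)
    \<le> expectation (\<lambda>\<omega>. exp (- (\<Sum>Y\<leftarrow>Ys. (Y \<omega>)\<^sup>2) / 2) * cos (Z \<omega>))"
  using assms(1-3,6,7)
\<comment> \<open>Phase and bound must vary: removing \<open>Y\<close> from the list replaces
  \<open>Z\<close> by \<open>Z + a * Y\<close>, with \<open>a\<close> the auxiliary normal
  variable.\<close>
proof (induction Ys arbitrary: Z x)
  case Nil
  then show ?case using assms expectation_cos[of Z] by simp
next
  case (Cons Y Ys)
  interpret N: real_distribution std_normal_distribution by (rule real_dist_normal_dist)
  interpret P: pair_sigma_finite M std_normal_distribution ..
  have L: "Y \<in> L" "set Ys \<subseteq> L" "Z \<in> L" using Cons.prems by auto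
  define D where "D = (\<lambda>\<omega>. exp (- (\<Sum>Y\<leftarrow>Ys. (Y \<omega>)\<^sup>2) / 2))"
  have "(\<lambda>\<omega>. \<Sum>Y\<leftarrow>Ys. (Y \<omega>)\<^sup>2) \<in> borel_measurable M"
    using L(2) measurable_L by (induction Ys) auto
  then have [measurable]: "D \<in> borel_measurable M" unfolding D_def by measurable
  have [measurable]: "Y \<in> borel_measurable M" "Z \<in> borel_measurable M"
    using L measurable_L by auto
  have D: "0 < D \<omega>" "D \<omega> \<le> 1" for \<omega>
    unfolding D_def by (auto intro!: sum_list_nonneg)
  define G where "G = (\<lambda>a. expectation (\<lambda>\<omega>. D \<omega> * cos (Z \<omega> + a * Y \<omega>)))"
  have bound: "norm (D \<omega> * cos z) \<le> 1" for \<omega> z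
    using D[of \<omega>] abs_cos_le_one[of z] by (simp add: abs_mult mult_le_one)
  have int: "integrable (M \<Otimes>\<^sub>M std_normal_distribution) (\<lambda>(\<omega>, a). D \<omega> * cos (Z \<omega> + a * Y \<omega>))"
  proof -
    interpret PP: pair_prob_space M std_normal_distribution ..
    show ?thesis
      by (rule PP.integrable_const_bound[where B = 1]) (use bound in auto)
  qed
  \<comment> \<open>The factor belonging to \<open>Y\<close> is the mean of
    \<open>cos (a * Y)\<close> over \<open>a\<close>; it merges with \<open>cos Z\<close>, and
    Fubini moves the integral over \<open>a\<close> outside.\<close>
  have "expectation (\<lambda>\<omega>. exp (- (\<Sum>Y\<leftarrow>Y # Ys. (Y \<omega>)\<^sup>2) / 2) * cos (Z \<omega>))
      = expectation (\<lambda>\<omega>. LINT a|std_normal_distribution. D \<omega> * cos (Z \<omega> + a * Y \<omega>))"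
    by (intro Bochner_Integration.integral_cong refl)
       (simp add: integral_std_normal_cos D_def exp_add[symmetric] field_simps)
  also have "\<dots> = (LINT a|std_normal_distribution. G a)"
    unfolding G_def by (rule P.Fubini_integral[OF int, symmetric])
  finally have eq: "expectation (\<lambda>\<omega>. exp (- (\<Sum>Y\<leftarrow>Y # Ys. (Y \<omega>)\<^sup>2) / 2) * cos (Z \<omega>))
      = (LINT a|std_normal_distribution. G a)" .
  \<comment> \<open>The bound \<open>y\<close> on the deviation of \<open>a * Y\<close> is left
    free: it is \<open>b * s\<close> for the retained values of \<open>a\<close>, and
    \<open>\<bar>a\<bar> * s\<close> for the others.\<close>
  have G: "p ^ length Ys * exp (- (x + y + length Ys * (b * s))\<^sup>2 / 2) \<le> G a"
    if "\<bar>a\<bar> * s \<le> y" "0 < y" for a y :: real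
    unfolding G_def D_def
  proof (rule Cons.IH)
    show "(\<lambda>\<omega>. Z \<omega> + a * Y \<omega>) \<in> L" using L closed_add closed_scale by blast
    have "expectation (\<lambda>\<omega>. (a * Y \<omega>)\<^sup>2) = a\<^sup>2 * expectation (\<lambda>\<omega>. (Y \<omega>)\<^sup>2)"
      by (simp add: power_mult_distrib)
    also have "\<dots> \<le> a\<^sup>2 * s\<^sup>2" using Cons.prems by (intro mult_left_mono) auto
    also have "\<dots> = (\<bar>a\<bar> * s)\<^sup>2" by (simp add: power_mult_distrib)
    also have "\<dots> \<le> y\<^sup>2" using that assms(4) by (intro power_mono) auto
    finally show "expectation (\<lambda>\<omega>. (Z \<omega> + a * Y \<omega>)\<^sup>2) \<le> (x + y)\<^sup>2"
      using that L Cons.prems by (intro L2_triangle closed_scale) auto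
  qed (use that Cons.prems in auto)
  let ?c = "p ^ length Ys * exp (- (x + b * s + length Ys * (b * s))\<^sup>2 / 2)"
  have "p * ?c \<le> measure std_normal_distribution {a. \<bar>a\<bar> \<le> b} * ?c"
    using assms by (intro mult_right_mono) auto
  also have "\<dots> = (LINT a|std_normal_distribution. indicator {a. \<bar>a\<bar> \<le> b} a * ?c)"
    by simp
  also have "\<dots> \<le> (LINT a|std_normal_distribution. G a)"
  proof (rule integral_mono)
    show "integrable std_normal_distribution G"
      using P.integrable_snd[OF int] by (simp add: G_def)
    fix a :: real
    show "indicator {a. \<bar>a\<bar> \<le> b} a * ?c \<le> G a"
    proof (cases "\<bar>a\<bar> \<le> b")
      case True
      then show ?thesis using G[of a "b * s"] assms by (simp add: mult_right_mono)
    next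
      \<comment> \<open>Dropping large \<open>a\<close> is legitimate only because
        \<open>G a\<close> is nonnegative although its cosine changes sign; the induction hypothesis
        gives exactly this.\<close>
      case False
      then have "\<bar>a\<bar> > 0" using assms by linarith
      then have "0 \<le> p ^ length Ys * exp (- (x + \<bar>a\<bar> * s + length Ys * (b * s))\<^sup>2 / 2)" using assms by simp
      also have "\<dots> \<le> G a" using G[of a "\<bar>a\<bar> * s"] assms \<open>\<bar>a\<bar> > 0\<close> by simp
      finally show ?thesis using False by simp
    qed
  qed (auto intro!: integrable_mult_left integrable_real_indicator simp: N.emeasure_eq_measure)
  finally show ?case unfolding eq by (simp add: algebra_simps)
qed

text \<open>Outside the ball some coordinate exceeds \<epsilon>, so the Gaussian functional at scale
  \<delta> is at most \<open>exp (- (\<epsilon> / \<delta>)\<^sup>2 / 2)\<close> there and at most 1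
  inside. Its expectation therefore exceeds the ball probability by at most that amount, whatever
  the correlations of the \<open>Y j\<close>.\<close>

lemma small_ball_lower_bound:
  fixes s \<delta> \<epsilon> :: real and Y :: "nat \<Rightarrow> 'a \<Rightarrow> real"
  assumes "\<And>j. j < m \<Longrightarrow> Y j \<in> L" "\<And>j. j < m \<Longrightarrow> expectation (\<lambda>\<omega>. (Y j \<omega>)\<^sup>2) \<le> s\<^sup>2"
    and "0 < m" "1 \<le> s" "0 < \<delta>" "\<delta> \<le> 1" "0 < \<epsilon>"
  shows "exp (- 2) * (\<delta> / (3 * s * m)) ^ m - exp (- (\<epsilon> / \<delta>)\<^sup>2 / 2)
    \<le> prob {\<omega>\<in>space M. \<forall>j<m. \<bar>Y j \<omega>\<bar> \<le> \<epsilon>}"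
proof -
  have [measurable]: "Y j \<in> borel_measurable M" if "j < m" for j using that assms(1) measurable_L by auto
  define Ys where "Ys = map (\<lambda>j \<omega>. 1 / \<delta> * Y j \<omega>) [0..<m]"
  \<comment> \<open>Each of the \<open>m\<close> variables adds \<open>b * (s / \<delta>)\<close> to
    the phase bound; this \<open>b\<close> makes the total 1. The zero phase starts with the bound
    1, whence \<open>exp (- (1 + 1)\<^sup>2 / 2) = exp (- 2)\<close>.\<close>
  define b where "b = \<delta> / (s * m)"
  have len: "length Ys = m" by (simp add: Ys_def)
  have b: "0 < b" "b \<le> 1"
  proof -
    show "0 < b" using assms by (simp add: b_def)
    have "\<delta> \<le> 1 * 1" using assms by simp
    also have "\<dots> \<le> s * m" using assms by (intro mult_mono) auto
    finally show "b \<le> 1" using assms by (simp add: b_def)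
  qed
  define Q where "Q = (\<lambda>\<omega>. exp (- (\<Sum>Y\<leftarrow>Ys. (Y \<omega>)\<^sup>2) / 2))"
  define A where "A = {\<omega>\<in>space M. \<forall>j<m. \<bar>Y j \<omega>\<bar> \<le> \<epsilon>}"
  have [measurable]: "A \<in> sets M" unfolding A_def by measurable
  have Qsum: "(\<Sum>Y\<leftarrow>Ys. (Y \<omega>)\<^sup>2) = (\<Sum>j<m. (Y j \<omega> / \<delta>)\<^sup>2)" for \<omega>
    by (simp add: Ys_def interv_sum_list_conv_sum_set_nat o_def atLeast0LessThan)
  have "(b / 3) ^ length Ys * exp (- (1 + length Ys * (b * (s / \<delta>)))\<^sup>2 / 2)
      \<le> expectation (\<lambda>\<omega>. Q \<omega> * cos 0)"
    unfolding Q_def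
  proof (rule gaussian_functional_lower_bound[where Z = "\<lambda>_. 0"])
    show "set Ys \<subseteq> L" using assms by (auto simp: Ys_def intro!: closed_scale[of _ "1 / \<delta>", simplified])
    show "(\<lambda>\<omega>. 0) \<in> L" using zero_in_L assms by blast
    show "b / 3 \<le> measure std_normal_distribution {a. \<bar>a\<bar> \<le> b}"
      using b by (intro std_normal_near_zero) auto
    fix W assume "W \<in> set Ys"
    then obtain j where j: "j < m" "W = (\<lambda>\<omega>. 1 / \<delta> * Y j \<omega>)" by (auto simp: Ys_def)
    then have "expectation (\<lambda>\<omega>. (W \<omega>)\<^sup>2) = expectation (\<lambda>\<omega>. (Y j \<omega>)\<^sup>2) / \<delta>\<^sup>2"
      by (simp add: power_divide)
    also have "\<dots> \<le> s\<^sup>2 / \<delta>\<^sup>2" using assms j by (intro divide_right_mono) auto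
    finally show "expectation (\<lambda>\<omega>. (W \<omega>)\<^sup>2) \<le> (s / \<delta>)\<^sup>2" by (simp add: power_divide)
  qed (use assms b in auto)
  moreover have one: "length Ys * (b * (s / \<delta>)) = 1" using assms by (simp add: b_def len)
  ultimately have 1: "(b / 3) ^ m * exp (- 2) \<le> expectation Q" unfolding one by (simp add: len)
  have "expectation Q \<le> expectation (\<lambda>\<omega>. indicator A \<omega> + exp (- (\<epsilon> / \<delta>)\<^sup>2 / 2))"
  proof (rule integral_mono)
    show "integrable M Q"
      by (rule integrable_const_bound[where B = 1]) (auto simp: Q_def Qsum intro!: sum_nonneg)
    fix \<omega> assume \<omega>: "\<omega> \<in> space M"
    show "Q \<omega> \<le> indicator A \<omega> + exp (- (\<epsilon> / \<delta>)\<^sup>2 / 2)"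
    proof (cases "\<omega> \<in> A")
      case True
      then show ?thesis by (auto simp: Q_def Qsum intro!: sum_nonneg add_increasing2)
    next
      case False
      then obtain j where j: "j < m" "\<epsilon> < \<bar>Y j \<omega>\<bar>" using \<omega> by (auto simp: A_def)
      have "(\<epsilon> / \<delta>)\<^sup>2 \<le> (\<bar>Y j \<omega>\<bar> / \<delta>)\<^sup>2" using j assms by (intro power_mono divide_right_mono) auto
      also have "\<dots> = (Y j \<omega> / \<delta>)\<^sup>2" by (simp add: power_divide)
      also have "\<dots> \<le> (\<Sum>j<m. (Y j \<omega> / \<delta>)\<^sup>2)" using j by (intro member_le_sum) auto
      finally show ?thesis using False by (simp add: Q_def Qsum)
    qed
  qed (auto intro!: integrable_add integrable_real_indicator simp: emeasure_eq_measure)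
  also have "\<dots> = prob A + exp (- (\<epsilon> / \<delta>)\<^sup>2 / 2)"
    by (subst Bochner_Integration.integral_add)
       (auto simp: prob_space emeasure_eq_measure intro!: integrable_real_indicator)
  finally show ?thesis using 1 by (simp add: A_def b_def field_simps)
qed

end

section \<open>Spectral representation of variances\<close>

definition lin_combs :: "(real \<Rightarrow> 'a \<Rightarrow> real) \<Rightarrow> ('a \<Rightarrow> real) set" where
  "lin_combs X = {\<lambda>\<omega>. \<Sum>t\<in>J. a t * X t \<omega> | J a. finite J}"

lemma gaussian_space_lin_combs:
  assumes "gaussian_process M X" "centered M X"
  shows "gaussian_space M (lin_combs X)"
proof -
  interpret prob_space M using assms by (simp add: gaussian_process_def)
  show ?thesis
  proof
    fix Z assume "Z \<in> lin_combs X"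
    then obtain J a where J: "finite J" "Z = (\<lambda>\<omega>. \<Sum>t\<in>J. a t * X t \<omega>)"
      unfolding lin_combs_def by blast
    show "gaussian_rv M Z" using assms J by (simp add: gaussian_process_def)
    show "expectation Z = 0" using assms(2) J by (simp add: centered_def)
    show "(\<lambda>\<omega>. c * Z \<omega>) \<in> lin_combs X" for c
      unfolding lin_combs_def
      by (rule CollectI, rule exI[of _ J], rule exI[of _ "\<lambda>t. c * a t"])
         (simp add: J sum_distrib_left mult.assoc)
    fix W assume "W \<in> lin_combs X"
    then obtain K b where K: "finite K" "W = (\<lambda>\<omega>. \<Sum>t\<in>K. b t * X t \<omega>)"
      unfolding lin_combs_def by blast
    \<comment> \<open>Padding with zero coefficients brings both sums to one index set, where the
      coefficients of shared times can be added.\<close>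
    have ext: "(\<Sum>t\<in>A. d t * X t \<omega>) = (\<Sum>t\<in>J \<union> K. (if t \<in> A then d t else 0) * X t \<omega>)"
      if "A \<subseteq> J \<union> K" for A d \<omega>
      using that J K by (intro sum.mono_neutral_cong_left) auto
    show "(\<lambda>\<omega>. Z \<omega> + W \<omega>) \<in> lin_combs X"
      unfolding lin_combs_def
      by (rule CollectI, rule exI[of _ "J \<union> K"],
          rule exI[of _ "\<lambda>t. (if t \<in> J then a t else 0) + (if t \<in> K then b t else 0)"])
         (simp add: J K ext[of J] ext[of K] sum.distrib distrib_right)
  qed
qed

lemma lin_combs_single: "X t \<in> lin_combs X"
  unfolding lin_combs_def by (rule CollectI, rule exI[of _ "{t}"], rule exI[of _ "\<lambda>_. 1"]) simp

text \<open>The spectral isometry sending \<open>X t\<close> to \<open>iexp (t * u)\<close>: both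
  sides expand into the same double sum of covariances. The times \<open>t i\<close> may repeat, as
  happens when an interpolation node coincides with the evaluation point.\<close>

lemma variance_spectral:
  assumes "gaussian_process M X" "centered M X" "has_spectral_measure M X F" "finite I"
  shows "(LINT \<omega>|M. (\<Sum>i\<in>I. b i * X (t i) \<omega>)\<^sup>2) = (LINT u|F. (cmod (\<Sum>i\<in>I. b i * iexp (t i * u)))\<^sup>2)"
proof -
  interpret gaussian_space M "lin_combs X" using assms by (intro gaussian_space_lin_combs)
  interpret F: finite_measure F using assms(3) by (simp add: has_spectral_measure_def)
  have sets[measurable_cong]: "sets F = sets borel"
    and cov: "complex_of_real (LINT \<omega>|M. X s \<omega> * X t \<omega>) = (CLINT u|F. iexp ((s - t) * u))" for s t
    using assms(3) by (auto simp: has_spectral_measure_def)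
  have sq: "(cmod (\<Sum>i\<in>I. b i * iexp (t i * u)))\<^sup>2
      = (\<Sum>i\<in>I. \<Sum>j\<in>I. b i * b j * iexp ((t i - t j) * u))" for u
  proof -
    have "complex_of_real ((cmod (\<Sum>i\<in>I. b i * iexp (t i * u)))\<^sup>2)
        = (\<Sum>i\<in>I. b i * iexp (t i * u)) * cnj (\<Sum>i\<in>I. b i * iexp (t i * u))"
      by (rule complex_norm_square)
    also have "\<dots> = (\<Sum>i\<in>I. b i * iexp (t i * u)) * (\<Sum>i\<in>I. b i * iexp (- t i * u))"
      by (simp add: exp_cnj)
    also have "\<dots> = (\<Sum>i\<in>I. \<Sum>j\<in>I. b i * b j * iexp ((t i - t j) * u))"
      unfolding sum_product by (intro sum.cong refl) (simp add: exp_add[symmetric] algebra_simps)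
    finally show ?thesis .
  qed
  have intF: "complex_integrable F (\<lambda>u. iexp (x * u))" for x
    by (rule F.integrable_const_bound[where B = 1]) auto
  have "complex_of_real (LINT \<omega>|M. (\<Sum>i\<in>I. b i * X (t i) \<omega>)\<^sup>2)
      = complex_of_real (LINT \<omega>|M. (\<Sum>i\<in>I. \<Sum>j\<in>I. b i * b j * (X (t i) \<omega> * X (t j) \<omega>)))"
    by (simp add: power2_eq_square sum_product mult_ac)
  also have "\<dots> = (\<Sum>i\<in>I. \<Sum>j\<in>I. b i * b j * complex_of_real (LINT \<omega>|M. X (t i) \<omega> * X (t j) \<omega>))"
    by (simp add: product_integrable lin_combs_single)
  also have "\<dots> = (CLINT u|F. (\<Sum>i\<in>I. \<Sum>j\<in>I. b i * b j * iexp ((t i - t j) * u)))"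
    unfolding cov using intF by (simp del: of_real_diff of_real_mult)
  also have "\<dots> = (CLINT u|F. complex_of_real ((cmod (\<Sum>i\<in>I. b i * iexp (t i * u)))\<^sup>2))"
    unfolding sq ..
  finally show ?thesis unfolding integral_complex_of_real of_real_eq_iff .
qed

section \<open>Even moments of the spectral measure\<close>

lemma powr_le_exp_scaled:
  fixes y p :: real
  assumes "0 \<le> y" "0 < p"
  shows "y powr p \<le> p powr p * exp y"
proof -
  have "y / p \<le> exp (y / p)" using exp_ge_add_one_self[of "y / p"] by linarith
  then have "(y / p) powr p \<le> exp (y / p) powr p" using assms by (intro powr_mono2) auto
  also have "\<dots> = exp y" using assms by (simp add: powr_def)
  finally show ?thesis using assms by (simp add: powr_divide field_simps)
qed

text \<open>The weight \<open>exp (- (\<bar>u\<bar> powr \<nu>))\<close> is split into two equal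
  factors. One absorbs \<open>u ^ (2 * N)\<close> through \<open>powr_le_exp_scaled\<close> with
  \<open>y = \<bar>u\<bar> powr \<nu> / 2\<close> and \<open>p = 2 * N / \<nu>\<close>, leaving
  \<open>(2 * p) powr p\<close>; the other is integrable, so \<open>C\<close> does not depend on
  \<open>N\<close>.\<close>

lemma spectral_F_moments:
  assumes "0 < \<nu>" "finite_measure (spectral_F \<nu>)"
  obtains C where "C > 0"
    "\<And>N. N \<ge> 1 \<Longrightarrow> integrable (spectral_F \<nu>) (\<lambda>u. u ^ (2 * N))"
    "\<And>N. N \<ge> 1 \<Longrightarrow> (LINT u|spectral_F \<nu>. u ^ (2 * N)) \<le> C * (4 * real N / \<nu>) powr (2 * real N / \<nu>)"
proof -
  interpret F: finite_measure "spectral_F \<nu>" by fact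
  let ?g = "\<lambda>u::real. exp (- (\<bar>u\<bar> powr \<nu>))"
  have "emeasure (spectral_F \<nu>) UNIV < \<infinity>"
    using F.emeasure_finite[of UNIV] by (simp add: less_top[symmetric])
  then have "integrable lborel ?g"
    by (intro integrableI_nonneg) (auto simp: spectral_F_def emeasure_density)
  \<comment> \<open>Scaling \<open>u\<close> by \<open>2 powr (- 1 / \<nu>)\<close> halves the
    exponent, so finiteness of the spectral measure also gives integrability of the remaining
    factor.\<close>
  from lborel_integrable_real_affine[OF this, of "2 powr (- 1 / \<nu>)" 0]
  have half: "integrable lborel (\<lambda>u::real. exp (- (\<bar>u\<bar> powr \<nu>) / 2))"
    using assms(1) by (simp add: abs_mult powr_mult powr_divide powr_powr powr_minus field_simps)
  define C where "C = (LINT u|lborel. exp (- (\<bar>u\<bar> powr \<nu>) / 2)) + 1"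
  have dom: "?g u * u ^ (2 * N) \<le> (4 * real N / \<nu>) powr (2 * real N / \<nu>) * exp (- (\<bar>u\<bar> powr \<nu>) / 2)"
    if "N \<ge> 1" for N :: nat and u :: real
  proof (cases "u = 0")
    case False
    let ?p = "2 * real N / \<nu>" and ?y = "\<bar>u\<bar> powr \<nu> / 2"
    have "u ^ (2 * N) = \<bar>u\<bar> powr real (2 * N)"
      using False by (subst powr_realpow) (auto simp: power_even_abs)
    also have "\<dots> = (\<bar>u\<bar> powr \<nu>) powr ?p" using assms(1) by (simp add: powr_powr)
    also have "\<dots> = 2 powr ?p * ?y powr ?p" by (simp add: powr_divide)
    also have "\<dots> \<le> 2 powr ?p * (?p powr ?p * exp ?y)"
      using assms(1) that by (intro mult_left_mono powr_le_exp_scaled) auto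
    also have "\<dots> = (4 * real N / \<nu>) powr ?p * exp ?y" using assms(1) by (simp add: powr_mult[symmetric])
    finally have "?g u * u ^ (2 * N) \<le> ?g u * ((4 * real N / \<nu>) powr ?p * exp ?y)" by simp
    also have "\<dots> = (4 * real N / \<nu>) powr ?p * (exp (- (\<bar>u\<bar> powr \<nu>)) * exp ?y)" by simp
    also have "exp (- (\<bar>u\<bar> powr \<nu>)) * exp ?y = exp (- (\<bar>u\<bar> powr \<nu>) / 2)"
      by (simp add: exp_add[symmetric])
    finally show ?thesis .
  qed (use that in \<open>auto simp: power_0_left\<close>)
  have int: "integrable lborel (\<lambda>u. ?g u * u ^ (2 * N))" if "N \<ge> 1" for N
    by (rule Bochner_Integration.integrable_bound[OF integrable_mult_right[OF half, of "(4 * real N / \<nu>) powr (2 * real N / \<nu>)"]])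
       (use dom[OF that] in \<open>auto simp: abs_mult\<close>)
  show thesis
  proof
    show "C > 0" unfolding C_def by (intro add_nonneg_pos integral_nonneg) auto
    fix N :: nat assume N: "N \<ge> 1"
    show "integrable (spectral_F \<nu>) (\<lambda>u. u ^ (2 * N))"
      unfolding spectral_F_def using int[OF N] by (subst integrable_real_density) auto
    have "(LINT u|spectral_F \<nu>. u ^ (2 * N)) = (LINT u|lborel. ?g u * u ^ (2 * N))"
      unfolding spectral_F_def by (subst integral_real_density) auto
    also have "\<dots> \<le> (LINT u|lborel. (4 * real N / \<nu>) powr (2 * real N / \<nu>) * exp (- (\<bar>u\<bar> powr \<nu>) / 2))"
      using N by (intro integral_mono int dom integrable_mult_right half)
    also have "\<dots> \<le> C * (4 * real N / \<nu>) powr (2 * real N / \<nu>)"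
      by (simp add: C_def algebra_simps)
    finally show "(LINT u|spectral_F \<nu>. u ^ (2 * N)) \<le> C * (4 * real N / \<nu>) powr (2 * real N / \<nu>)" .
  qed
qed

section \<open>Lagrange interpolation of exponentials\<close>

definition lagrange :: "nat \<Rightarrow> nat \<Rightarrow> real \<Rightarrow> real" where
  "lagrange N j y = (\<Prod>i\<in>{..<N} - {j}. (y - real i) / (real j - real i))"

lemma lagrange_node: "j < N \<Longrightarrow> l < N \<Longrightarrow> lagrange N j (real l) = (if l = j then 1 else 0)"
  unfolding lagrange_def by (auto intro!: prod.neutral prod_zero)

text \<open>Two polynomials of degree below \<open>N\<close> that agree at \<open>N\<close> distinct
  nodes are equal.\<close>

lemma lagrange_reproduces_powers:
  assumes "k < N"
  shows "(\<Sum>j<N. lagrange N j y * real j ^ k) = y ^ k"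
proof -
  define q where "q j = (\<Prod>i\<in>{..<N} - {j}. [:- real i / (real j - real i), 1 / (real j - real i):])" for j
  have q: "poly (q j) y = lagrange N j y" for j y
    by (simp add: q_def lagrange_def poly_prod diff_divide_distrib)
  have degq: "degree (q j) \<le> N - 1" if "j < N" for j
  proof -
    have "degree (q j) \<le> (\<Sum>i\<in>{..<N} - {j}. degree [:- real i / (real j - real i), 1 / (real j - real i):])"
      unfolding q_def by (rule order_trans[OF degree_prod_sum_le]) (simp_all add: o_def)
    also have "\<dots> \<le> (\<Sum>i\<in>{..<N} - {j}. 1)" by (intro sum_mono) auto
    also have "\<dots> = N - 1" using that by simp
    finally show ?thesis .
  qed
  have "(\<Sum>j<N. smult (real j ^ k) (q j)) = monom 1 k"
  proof (rule poly_eqI_degree)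
    have "degree (\<Sum>j<N. smult (real j ^ k) (q j)) \<le> N - 1"
    proof (intro degree_sum_le)
      show "degree (smult (real j ^ k) (q j)) \<le> N - 1" if "j \<in> {..<N}" for j
        using degq[of j] that degree_smult_le[of "real j ^ k" "q j"] by simp
    qed simp
    then show "degree (\<Sum>j<N. smult (real j ^ k) (q j)) < card (real ` {..<N})"
      using assms by (simp add: card_image)
    show "degree (monom (1::real) k) < card (real ` {..<N})"
      using assms by (simp add: card_image degree_monom_eq)
    fix x assume "x \<in> real ` {..<N}"
    then obtain l where l: "l < N" "x = real l" by auto
    have "poly (\<Sum>j<N. smult (real j ^ k) (q j)) x = (\<Sum>j<N. real j ^ k * lagrange N j (real l))"
      by (simp add: poly_sum q l)
    also have "\<dots> = (\<Sum>j<N. if l = j then real j ^ k else 0)"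
      using l by (intro sum.cong) (auto simp: lagrange_node)
    also have "\<dots> = poly (monom 1 k) x" using l by (simp add: poly_monom)
    finally show "poly (\<Sum>j<N. smult (real j ^ k) (q j)) x = poly (monom 1 k) x" .
  qed
  then have "poly (\<Sum>j<N. smult (real j ^ k) (q j)) y = poly (monom 1 k) y" by simp
  then show ?thesis by (simp add: poly_sum q poly_monom mult.commute)
qed

text \<open>Nodes to the left of \<open>j\<close> contribute \<open>fact j\<close>, nodes to its
  right \<open>fact (N - 1 - j)\<close>; together they turn the weights into binomial
  coefficients.\<close>

lemma prod_distance_to_node:
  assumes "j < N"
  shows "(\<Prod>i\<in>{..<N} - {j}. \<bar>real j - real i\<bar>) = fact j * fact (N - 1 - j)"
  using assms
proof (induction N)
  case (Suc n)
  show ?case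
  proof (cases "j = n")
    case True
    have "(\<Prod>i<n. \<bar>real n - real i\<bar>) = fact n"
      by (induction n) (auto simp: prod.lessThan_Suc_shift simp del: prod.lessThan_Suc)
    moreover have "{..<Suc n} - {n} = {..<n}" by auto
    ultimately show ?thesis using True by simp
  next
    case False
    then have j: "j < n" using Suc.prems by simp
    have "{..<Suc n} - {j} = insert n ({..<n} - {j})" using j by auto
    then have "(\<Prod>i\<in>{..<Suc n} - {j}. \<bar>real j - real i\<bar>) = \<bar>real j - n\<bar> * (fact j * fact (n - 1 - j))"
      using Suc.IH[OF j] by simp
    also have "\<bar>real j - n\<bar> = real (n - j)" using j by simp
    also have "real (n - j) * (fact j * fact (n - 1 - j)) = fact j * fact (n - j)"
      using j by (subst (2) fact_reduce) auto
    finally show ?thesis by simp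
  qed
qed simp

text \<open>A single term of the exponential series at \<open>N\<close> is at most
  \<open>exp N\<close>, and \<open>exp 1\<close> is at most 3.\<close>

lemma power_self_le_fact: "real N ^ N \<le> 3 ^ N * fact N"
proof -
  have "(\<Sum>n\<in>{N}. real N ^ n /\<^sub>R fact n) \<le> (\<Sum>n. real N ^ n /\<^sub>R fact n)"
    by (intro sum_le_suminf sums_summable[OF exp_converges]) auto
  also have "\<dots> = exp (real N)" using exp_converges[of "real N"] by (rule sums_unique[symmetric])
  also have "\<dots> = exp 1 ^ N" by (simp add: exp_of_nat_mult[symmetric])
  also have "\<dots> \<le> 3 ^ N" using exp_le by (intro power_mono) auto
  finally show ?thesis by (simp add: field_simps)
qed

text \<open>Numerators are at most \<open>N ^ (N - 1)\<close> and denominators are products of two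
  factorials, so a row of binomial coefficients remains, with the prefactor
  \<open>N ^ (N - 1) / fact (N - 1) = N ^ N / fact N\<close>. The range of \<open>y\<close> reaches
  one unit past the last node because \<open>N\<close> nodes serve a block of length
  \<open>N\<close>, and neighbouring blocks share no node.\<close>

lemma lagrange_abs_sum:
  fixes y :: real
  assumes "0 \<le> y" "y \<le> N" "1 \<le> N"
  shows "(\<Sum>j<N. \<bar>lagrange N j y\<bar>) \<le> 6 ^ N"
proof -
  obtain n where n: "N = Suc n" using assms by (cases N) auto
  have "\<bar>lagrange N j y\<bar> \<le> real N ^ n / fact n * (n choose j)" if "j < N" for j
  proof -
    have "\<bar>lagrange N j y\<bar> = (\<Prod>i\<in>{..<N} - {j}. \<bar>y - real i\<bar>) / (fact j * fact (n - j))"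
      using prod_distance_to_node[OF that] n
      by (simp add: lagrange_def abs_prod prod_dividef)
    also have "(\<Prod>i\<in>{..<N} - {j}. \<bar>y - real i\<bar>) \<le> (\<Prod>i\<in>{..<N} - {j}. real N)"
      using assms by (intro prod_mono) auto
    also have "\<dots> = real N ^ n" using that n by simp
    finally show ?thesis using that n by (simp add: binomial_fact divide_right_mono)
  qed
  then have "(\<Sum>j<N. \<bar>lagrange N j y\<bar>) \<le> (\<Sum>j<N. real N ^ n / fact n * (n choose j))"
    by (intro sum_mono) auto
  also have "\<dots> = real N ^ n / fact n * real (\<Sum>j\<le>n. n choose j)"
    by (simp add: n lessThan_Suc_atMost sum_distrib_left)
  also have "\<dots> = real N ^ N / fact N * 2 ^ n" by (simp add: n choose_row_sum)
  also have "\<dots> \<le> 3 ^ N * 2 ^ N"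
  proof (intro mult_mono)
    show "real N ^ N / fact N \<le> 3 ^ N" using power_self_le_fact[of N] by (simp add: pos_divide_le_eq)
    show "(2::real) ^ n \<le> 2 ^ N" by (intro power_increasing) (auto simp: n)
  qed auto
  also have "\<dots> = 6 ^ N" by (simp add: power_mult_distrib[symmetric])
  finally show ?thesis .
qed

text \<open>Interpolation reproduces the Taylor polynomial, hence only sees the Taylor remainders.\<close>
lemma lagrange_iexp_error:
  fixes y v :: real
  assumes "0 \<le> y" "y \<le> N" "1 \<le> N"
  shows "cmod (iexp (y * v) - (\<Sum>j<N. lagrange N j y * iexp (j * v))) \<le> (36 * \<bar>v\<bar>) ^ N"
proof -
  obtain n where n: "N = Suc n" using assms by (cases N) auto
  define T where "T x = (\<Sum>k\<le>n. (\<i> * complex_of_real x) ^ k / fact k)" for x :: real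
  have T: "T (y * v) = (\<Sum>j<N. lagrange N j y * T (j * v))"
  proof -
    have "(\<Sum>j<N. lagrange N j y * T (j * v))
        = (\<Sum>k\<le>n. (\<i> * complex_of_real v) ^ k / fact k * complex_of_real (\<Sum>j<N. lagrange N j y * real j ^ k))"
      unfolding T_def sum_distrib_left of_real_sum
      by (subst sum.swap) (simp add: power_mult_distrib mult_ac)
    also have "\<dots> = (\<Sum>k\<le>n. (\<i> * complex_of_real v) ^ k / fact k * complex_of_real (y ^ k))"
      using lagrange_reproduces_powers[of _ N y] by (intro sum.cong refl) (simp add: n)
    finally show ?thesis by (simp add: T_def power_mult_distrib mult_ac)
  qed
  have rem: "cmod (iexp (x * v) - T (x * v)) \<le> (3 * \<bar>v\<bar>) ^ N" if "0 \<le> x" "x \<le> N" for x :: real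
  proof -
    have "cmod (iexp (x * v) - T (x * v)) \<le> \<bar>x * v\<bar> ^ N / fact N"
      unfolding T_def n by (rule iexp_approx1)
    also have "\<dots> \<le> (N * \<bar>v\<bar>) ^ N / fact N"
      using that by (intro divide_right_mono power_mono) (auto simp: abs_mult mult_right_mono)
    also have "\<dots> = real N ^ N / fact N * \<bar>v\<bar> ^ N" by (simp add: power_mult_distrib)
    also have "\<dots> \<le> 3 ^ N * \<bar>v\<bar> ^ N"
      using power_self_le_fact[of N] by (intro mult_right_mono) (auto simp: field_simps)
    finally show ?thesis by (simp add: power_mult_distrib)
  qed
  have "iexp (y * v) - (\<Sum>j<N. lagrange N j y * iexp (j * v))
      = (iexp (y * v) - T (y * v)) - (\<Sum>j<N. lagrange N j y * (iexp (j * v) - T (j * v)))"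
    unfolding T by (simp add: algebra_simps sum_subtractf)
  also have "cmod \<dots> \<le> cmod (iexp (y * v) - T (y * v))
      + (\<Sum>j<N. cmod (lagrange N j y * (iexp (j * v) - T (j * v))))"
    by (intro order_trans[OF norm_triangle_ineq4] add_left_mono norm_sum)
  also have "\<dots> \<le> (3 * \<bar>v\<bar>) ^ N + (\<Sum>j<N. \<bar>lagrange N j y\<bar> * (3 * \<bar>v\<bar>) ^ N)"
  proof (intro add_mono sum_mono)
    show "cmod (iexp (y * v) - T (y * v)) \<le> (3 * \<bar>v\<bar>) ^ N" using assms by (intro rem)
    fix j assume "j \<in> {..<N}"
    then have "cmod (iexp (j * v) - T (j * v)) \<le> (3 * \<bar>v\<bar>) ^ N" by (intro rem) auto
    then show "cmod (lagrange N j y * (iexp (j * v) - T (j * v))) \<le> \<bar>lagrange N j y\<bar> * (3 * \<bar>v\<bar>) ^ N"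
      unfolding norm_mult norm_of_real by (intro mult_left_mono) auto
  qed
  also have "\<dots> = (1 + (\<Sum>j<N. \<bar>lagrange N j y\<bar>)) * (3 * \<bar>v\<bar>) ^ N"
    by (simp add: distrib_right sum_distrib_right)
  also have "\<dots> \<le> (6 ^ N + 6 ^ N) * (3 * \<bar>v\<bar>) ^ N"
    using lagrange_abs_sum[OF assms] by (intro mult_right_mono add_mono) auto
  \<comment> \<open>The factor 2 is absorbed as \<open>2 \<le> 2 ^ N\<close>, which is why the base
    is \<open>2 * 6 * 3 = 36\<close>.\<close>
  also have "\<dots> \<le> 2 ^ N * 6 ^ N * (3 * \<bar>v\<bar>) ^ N"
    using self_le_power[of "2::real" N] assms by (intro mult_right_mono) auto
  also have "\<dots> = (36 * \<bar>v\<bar>) ^ N" unfolding power_mult_distrib[symmetric] by simp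
  finally show ?thesis .
qed

section \<open>Chaining on dyadic points\<close>

definition dyadic_index :: "real \<Rightarrow> real \<Rightarrow> nat \<Rightarrow> nat" where
  "dyadic_index T t n = nat \<lfloor>2 ^ n * (t / T)\<rfloor>"

lemma
  fixes t T :: real
  assumes "t \<in> {0..T}" "0 < T"
  shows dyadic_index_le: "dyadic_index T t n \<le> 2 ^ n"
    and dyadic_index_Suc: "dyadic_index T t (Suc n) \<in> {2 * dyadic_index T t n, Suc (2 * dyadic_index T t n)}"
    and dyadic_index_tendsto: "(\<lambda>n. dyadic_index T t n * T / 2 ^ n) \<longlonglongrightarrow> t"
proof -
  define s where "s = t / T"
  have s: "0 \<le> s" "s \<le> 1" "t = s * T" using assms by (auto simp: s_def)
  have nonneg: "0 \<le> \<lfloor>2 ^ n * s\<rfloor>" for n using s by simp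
  have "2 ^ n * s \<le> 2 ^ n * 1" using s by (intro mult_left_mono) auto
  then have "2 ^ n * s < of_int (2 ^ n) + 1"
    unfolding of_int_power of_int_numeral by linarith
  then have "\<lfloor>2 ^ n * s\<rfloor> \<le> 2 ^ n" unfolding floor_le_iff .
  then show "dyadic_index T t n \<le> 2 ^ n"
    unfolding dyadic_index_def s_def[symmetric] by (simp add: nat_le_iff)
  have "\<lfloor>2 ^ Suc n * s\<rfloor> = 2 * \<lfloor>2 ^ n * s\<rfloor> \<or> \<lfloor>2 ^ Suc n * s\<rfloor> = 2 * \<lfloor>2 ^ n * s\<rfloor> + 1"
    unfolding power_Suc mult.assoc by linarith
  moreover obtain k where "\<lfloor>2 ^ n * s\<rfloor> = int k" using nonneg[of n] zero_le_imp_eq_int by blast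
  ultimately show "dyadic_index T t (Suc n) \<in> {2 * dyadic_index T t n, Suc (2 * dyadic_index T t n)}"
    unfolding dyadic_index_def s_def[symmetric] by (auto simp: nat_add_distrib nat_mult_distrib)
  have lim: "(\<lambda>n. (1/2) ^ n * T) \<longlonglongrightarrow> 0"
    by (rule tendsto_mult_left_zero) (rule LIMSEQ_power_zero, simp)
  have bound: "\<bar>dyadic_index T t n * T / 2 ^ n - t\<bar> \<le> (1/2) ^ n * T" for n
  proof -
    have "real (dyadic_index T t n) = of_int \<lfloor>2 ^ n * s\<rfloor>"
      unfolding dyadic_index_def s_def[symmetric] using nonneg[of n] by simp
    moreover have "\<bar>of_int \<lfloor>2 ^ n * s\<rfloor> - 2 ^ n * s\<bar> \<le> 1" by linarith
    ultimately have "\<bar>real (dyadic_index T t n) - 2 ^ n * s\<bar> * (T / 2 ^ n) \<le> 1 * (T / 2 ^ n)"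
      using assms(2) by (intro mult_right_mono) auto
    also have "\<bar>real (dyadic_index T t n) - 2 ^ n * s\<bar> * (T / 2 ^ n)
        = \<bar>(real (dyadic_index T t n) - 2 ^ n * s) * (T / 2 ^ n)\<bar>"
      using assms(2) by (simp add: abs_mult)
    also have "(real (dyadic_index T t n) - 2 ^ n * s) * (T / 2 ^ n) = dyadic_index T t n * T / 2 ^ n - t"
      using s(3) by (simp add: field_simps)
    finally show ?thesis by (simp add: power_divide)
  qed
  have "(\<lambda>n. dyadic_index T t n * T / 2 ^ n - t) \<longlonglongrightarrow> 0"
    by (rule Lim_null_comparison[OF always_eventually lim]) (use bound in simp)
  then show "(\<lambda>n. dyadic_index T t n * T / 2 ^ n) \<longlonglongrightarrow> t" by (simp add: LIM_zero_iff)
qed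

lemma bounded_on_dyadics:
  fixes f :: "real \<Rightarrow> real" and t T :: real
  assumes "continuous_on UNIV f" "0 < T" "t \<in> {0..T}"
    and "\<And>n k. k \<le> 2 ^ n \<Longrightarrow> \<bar>f (real k * T / 2 ^ n)\<bar> \<le> r"
  shows "\<bar>f t\<bar> \<le> r"
proof (rule LIMSEQ_le_const2)
  show "(\<lambda>n. \<bar>f (dyadic_index T t n * T / 2 ^ n)\<bar>) \<longlonglongrightarrow> \<bar>f t\<bar>"
    using assms(1) by (intro tendsto_rabs continuous_on_tendsto_compose[of UNIV f]
      dyadic_index_tendsto assms) auto
qed (use assms dyadic_index_le in auto)

text \<open>The point \<open>t\<close> is reached along its left dyadic neighbours. Passing to the
  next level, the neighbour either stays or moves to the adjacent point of the finer grid, so at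
  most one increment per level is paid and these form a geometric series.\<close>

lemma dyadic_chaining:
  fixes f :: "real \<Rightarrow> real" and t T :: real
  assumes cont: "continuous_on UNIV f" and T: "0 < T" and t: "t \<in> {0..T}"
    and q: "0 \<le> q" "q < 1" and \<rho>: "0 \<le> \<rho>"
    and base: "\<And>k. k \<le> 2 ^ n\<^sub>0 \<Longrightarrow> \<bar>f (real k * T / 2 ^ n\<^sub>0)\<bar> \<le> B"
    and incr: "\<And>j k. k < 2 ^ (n\<^sub>0 + Suc j) \<Longrightarrow>
      \<bar>f (real (Suc k) * T / 2 ^ (n\<^sub>0 + Suc j)) - f (real k * T / 2 ^ (n\<^sub>0 + Suc j))\<bar> \<le> \<rho> * q ^ j"
  shows "\<bar>f t\<bar> \<le> B + \<rho> / (1 - q)"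
proof -
  define x where "x j = f (dyadic_index T t (n\<^sub>0 + j) * T / 2 ^ (n\<^sub>0 + j))" for j
  have step: "\<bar>x (Suc j)\<bar> \<le> \<bar>x j\<bar> + \<rho> * q ^ j" for j
  proof -
    define k where "k = dyadic_index T t (n\<^sub>0 + j)"
    have xj: "x j = f (real (2 * k) * T / 2 ^ (n\<^sub>0 + Suc j))" by (simp add: x_def k_def)
    have "dyadic_index T t (n\<^sub>0 + Suc j) \<in> {2 * k, Suc (2 * k)}"
      using dyadic_index_Suc[OF t T, of "n\<^sub>0 + j"] by (simp add: k_def)
    then consider "dyadic_index T t (n\<^sub>0 + Suc j) = 2 * k" | "dyadic_index T t (n\<^sub>0 + Suc j) = Suc (2 * k)"
      by blast
    then show ?thesis
    proof cases
      case 1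
      then show ?thesis unfolding x_def[of "Suc j"] using q \<rho> by (simp add: xj)
    next
      case 2
      then have "Suc (2 * k) \<le> 2 ^ (n\<^sub>0 + Suc j)"
        using dyadic_index_le[OF t T, of "n\<^sub>0 + Suc j"] by simp
      then show ?thesis using incr[of "2 * k" j] xj unfolding x_def[of "Suc j"] 2 by linarith
    qed
  qed
  have "\<bar>x j\<bar> \<le> B + (\<Sum>i<j. \<rho> * q ^ i)" for j
  proof (induction j)
    case 0
    then show ?case using base[OF dyadic_index_le[OF t T]] by (simp add: x_def)
  next
    case (Suc j)
    then show ?case using step[of j] by simp
  qed
  also have "B + (\<Sum>i<j. \<rho> * q ^ i) \<le> B + \<rho> / (1 - q)" for j
  proof -
    have "(\<Sum>i<j. q ^ i) = (1 - q ^ j) / (1 - q)" using q by (subst sum_gp_strict) auto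
    also have "\<dots> \<le> 1 / (1 - q)" using q by (intro divide_right_mono) auto
    finally show ?thesis using mult_left_mono[OF _ \<rho>] by (fastforce simp: sum_distrib_left[symmetric])
  qed
  finally have "\<bar>x j\<bar> \<le> B + \<rho> / (1 - q)" for j .
  moreover have "(\<lambda>j. \<bar>x j\<bar>) \<longlonglongrightarrow> \<bar>f t\<bar>"
  proof -
    have "(\<lambda>j. dyadic_index T t (n\<^sub>0 + j) * T / 2 ^ (n\<^sub>0 + j)) \<longlonglongrightarrow> t"
      using LIMSEQ_ignore_initial_segment[OF dyadic_index_tendsto[OF t T], of n\<^sub>0] by (simp add: add.commute)
    then show ?thesis unfolding x_def
      by (intro tendsto_rabs continuous_on_tendsto_compose[OF cont]) auto
  qed
  ultimately show ?thesis by (intro LIMSEQ_le_const2) auto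
qed

section \<open>Suprema over an interval\<close>

text \<open>Continuity reduces the uncountable intersection over \<open>t\<close> to the countable
  one over dyadic points.\<close>

lemma (in prob_space) bounded_path_measurable:
  fixes X :: "real \<Rightarrow> 'a \<Rightarrow> real"
  assumes "\<And>t. X t \<in> borel_measurable M" "\<And>\<omega>. \<omega> \<in> space M \<Longrightarrow> continuous_on UNIV (\<lambda>t. X t \<omega>)" "0 < T"
  shows "{\<omega>\<in>space M. \<forall>t\<in>{0..T}. \<bar>X t \<omega>\<bar> \<le> r} \<in> sets M"
proof -
  note [measurable] = assms(1)
  have "{\<omega>\<in>space M. \<forall>t\<in>{0..T}. \<bar>X t \<omega>\<bar> \<le> r}
      = {\<omega>\<in>space M. \<forall>n. \<forall>k\<le>2 ^ n. \<bar>X (real k * T / 2 ^ n) \<omega>\<bar> \<le> r}"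
  proof safe
    fix \<omega> n k
    assume *: "\<forall>t\<in>{0..T}. \<bar>X t \<omega>\<bar> \<le> r" and k: "k \<le> (2::nat) ^ n"
    have "real k \<le> 2 ^ n" using k by (metis of_nat_le_iff of_nat_numeral of_nat_power)
    then have "real k * T / 2 ^ n \<in> {0..T}" using assms(3) by (simp add: field_simps)
    then show "\<bar>X (real k * T / 2 ^ n) \<omega>\<bar> \<le> r" using * by blast
  next
    fix \<omega> t
    assume "\<omega> \<in> space M" "\<forall>n. \<forall>k\<le>2 ^ n. \<bar>X (real k * T / 2 ^ n) \<omega>\<bar> \<le> r" "t \<in> {0..T}"
    then show "\<bar>X t \<omega>\<bar> \<le> r"
      using bounded_on_dyadics[OF assms(2,3), of \<omega> t r] by blast
  qed
  then show ?thesis by simp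
qed

text \<open>If all node values are at most \<open>r / (4 * \<Lambda>)\<close>, the interpolant is at most \<open>r / 4\<close>; the
  interpolation error on the dyadic grid of level \<open>n\<^sub>0\<close> costs another \<open>r / 4\<close> and chaining the last
  \<open>r / 2\<close>, outside events whose probability is subtracted.\<close>
lemma (in gaussian_space) sup_lower_bound:
  fixes X :: "real \<Rightarrow> 'a \<Rightarrow> real" and T r s V \<sigma> \<Lambda> \<delta> K :: real and node :: "nat \<Rightarrow> real" and m n\<^sub>0 :: nat
  assumes X: "\<And>t. X t \<in> L" and cont: "\<And>\<omega>. \<omega> \<in> space M \<Longrightarrow> continuous_on UNIV (\<lambda>t. X t \<omega>)"
    and T: "0 < T" and r: "0 < r"
    and var: "\<And>t. expectation (\<lambda>\<omega>. (X t \<omega>)\<^sup>2) \<le> s\<^sup>2" and s: "1 \<le> s"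
    and incr: "\<And>t t'. expectation (\<lambda>\<omega>. (X t \<omega> - X t' \<omega>)\<^sup>2) \<le> (V * (t - t'))\<^sup>2" and V: "0 < V"
    and approx: "\<And>t. t \<in> {0..T} \<Longrightarrow>
      expectation (\<lambda>\<omega>. (X t \<omega> - (\<Sum>j<m. w t j * X (node j) \<omega>))\<^sup>2) \<le> \<sigma>\<^sup>2" and \<sigma>: "0 < \<sigma>"
    and weights: "\<And>t. t \<in> {0..T} \<Longrightarrow> (\<Sum>j<m. \<bar>w t j\<bar>) \<le> \<Lambda>" and \<Lambda>: "0 < \<Lambda>"
    and m: "0 < m" and \<delta>: "0 < \<delta>" "\<delta> \<le> 1"
    and K: "K = r * 2 ^ n\<^sub>0 / (8 * V * T)" "exp (- K\<^sup>2) \<le> 1 / 4"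
  shows "exp (- 2) * (\<delta> / (3 * s * m)) ^ m - exp (- (r / (4 * \<Lambda>) / \<delta>)\<^sup>2 / 2)
      - 2 * (2 ^ n\<^sub>0 + 1) * exp (- (r / 4 / \<sigma>)\<^sup>2 / 4) - 2 ^ (n\<^sub>0 + 3) * exp (- K\<^sup>2)
    \<le> prob {\<omega>\<in>space M. \<forall>t\<in>{0..T}. \<bar>X t \<omega>\<bar> \<le> r}"
proof -
  have [measurable]: "X t \<in> borel_measurable M" for t using X measurable_L by blast
  have nonempty: "L \<noteq> {}" using X by blast
  define G where "G = {\<omega>\<in>space M. \<forall>t\<in>{0..T}. \<bar>X t \<omega>\<bar> \<le> r}"
  define A where "A = {\<omega>\<in>space M. \<forall>j<m. \<bar>X (node j) \<omega>\<bar> \<le> r / (4 * \<Lambda>)}"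
  define R where "R = (\<lambda>t \<omega>. X t \<omega> - (\<Sum>j<m. w t j * X (node j) \<omega>))"
  define grid where "grid n k = real k * T / 2 ^ n" for n k
  define B where "B k = {\<omega>\<in>space M. r / 4 < \<bar>R (grid n\<^sub>0 k) \<omega>\<bar>}" for k
  \<comment> \<open>The thresholds sum to \<open>(r / 8) / (1 - 3/4) = r / 2\<close>. Their ratio
    \<open>3/4\<close> exceeds \<open>1/2\<close>, the ratio of the bounds on the standard
    deviations of increments, so relative to those bounds they grow like
    \<open>(3/2) ^ j\<close>.\<close>
  define D where "D j k = {\<omega>\<in>space M. r / 8 * (3/4) ^ j <
    \<bar>X (grid (n\<^sub>0 + Suc j) (Suc k)) \<omega> - X (grid (n\<^sub>0 + Suc j) k) \<omega>\<bar>}" for j k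
  define C where "C j = (\<Union>k\<in>{..<2 ^ (n\<^sub>0 + Suc j)}. D j k)" for j
  have [measurable]: "R t \<in> borel_measurable M" for t unfolding R_def by measurable
  have [measurable]: "A \<in> sets M" "B k \<in> sets M" "D j k \<in> sets M" for j k
    unfolding A_def B_def D_def by measurable
  have [measurable]: "C j \<in> sets M" for j unfolding C_def by measurable
  have [measurable]: "G \<in> sets M" unfolding G_def by (intro bounded_path_measurable cont T) auto
  have grid: "grid n\<^sub>0 k \<in> {0..T}" if "k \<le> 2 ^ n\<^sub>0" for k
  proof -
    have "real k \<le> 2 ^ n\<^sub>0" using that by (metis of_nat_le_iff of_nat_numeral of_nat_power)
    then show ?thesis using T by (simp add: grid_def field_simps)
  qed
  have R_L: "R t \<in> L" for t
    unfolding R_def by (intro closed_diff X closed_sum nonempty closed_scale) auto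
  have probB: "prob (B k) \<le> 2 * exp (- (r / 4 / \<sigma>)\<^sup>2 / 4)" if "k \<le> 2 ^ n\<^sub>0" for k
    unfolding B_def using r \<sigma> approx[OF grid[OF that]]
    by (intro tail_bound R_L) (auto simp: R_def)
  have probD: "prob (D j k) \<le> 2 * (exp (- K\<^sup>2) * (1/4) ^ j)" for j k
  proof -
    let ?s = "V * T / 2 ^ (n\<^sub>0 + Suc j)"
    have "expectation (\<lambda>\<omega>. (X (grid (n\<^sub>0 + Suc j) (Suc k)) \<omega> - X (grid (n\<^sub>0 + Suc j) k) \<omega>)\<^sup>2) \<le> ?s\<^sup>2"
      using incr[of "grid (n\<^sub>0 + Suc j) (Suc k)" "grid (n\<^sub>0 + Suc j) k"]
      by (simp add: grid_def field_simps)
    then have "prob (D j k) \<le> 2 * exp (- (r / 8 * (3/4) ^ j / ?s)\<^sup>2 / 4)"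
      unfolding D_def using r V T by (intro tail_bound closed_diff X) auto
    also have "r / 8 * (3/4) ^ j / ?s = 2 * K * (3/2) ^ j"
    proof -
      have "(3/4::real) ^ j * 2 ^ j = (3/2) ^ j" unfolding power_mult_distrib[symmetric] by simp
      then show ?thesis unfolding K(1) using T V by (simp add: power_add field_simps)
    qed
    also have "- (2 * K * (3/2) ^ j)\<^sup>2 / 4 = - (K\<^sup>2 * (9/4) ^ j)"
      by (simp add: power_mult_distrib power2_eq_square power_mult_distrib[symmetric])
    \<comment> \<open>Bernoulli replaces the exponential growth in the exponent by a linear one.
      With \<open>exp (- K\<^sup>2) \<le> 1 / 4\<close> this leaves a factor
      \<open>(1/4) ^ j\<close>, enough against the doubling of the number of increments per
      level.\<close>
    also have "exp \<dots> \<le> exp (- (K\<^sup>2 * (1 + j)))"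
    proof -
      have "1 + real j * (5/4) \<le> (1 + 5/4) ^ j" by (rule Bernoulli_inequality) simp
      then have "1 + real j \<le> (9/4) ^ j" by simp
      then show ?thesis by (simp add: mult_left_mono)
    qed
    also have "\<dots> = exp (- K\<^sup>2) * exp (- K\<^sup>2) ^ j"
      by (simp add: exp_add[symmetric] exp_of_nat_mult[symmetric] algebra_simps)
    also have "\<dots> \<le> exp (- K\<^sup>2) * (1/4) ^ j" using K(2) by (intro mult_left_mono power_mono) auto
    finally show ?thesis by simp
  qed
  have probC: "prob (C j) \<le> 2 ^ (n\<^sub>0 + 2) * exp (- K\<^sup>2) * (1/2) ^ j" for j
  proof -
    have "prob (C j) \<le> (\<Sum>k<2 ^ (n\<^sub>0 + Suc j). prob (D j k))"
      unfolding C_def by (intro finite_measure_subadditive_finite) auto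
    also have "\<dots> \<le> (\<Sum>k<(2::nat) ^ (n\<^sub>0 + Suc j). 2 * (exp (- K\<^sup>2) * (1/4) ^ j))"
      by (intro sum_mono probD)
    also have "\<dots> = 2 ^ (n\<^sub>0 + 2) * exp (- K\<^sup>2) * (2 ^ j * (1/4) ^ j)"
      by (simp add: power_add)
    also have "(2::real) ^ j * (1/4) ^ j = (1/2) ^ j" unfolding power_mult_distrib[symmetric] by simp
    finally show ?thesis .
  qed
  have geo: "(\<lambda>j. 2 ^ (n\<^sub>0 + 2) * exp (- K\<^sup>2) * (1/2) ^ j) sums (2 ^ (n\<^sub>0 + 3) * exp (- K\<^sup>2))"
    using sums_mult[OF geometric_sums[of "1/2::real"], of "2 ^ (n\<^sub>0 + 2) * exp (- K\<^sup>2)"]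
    by (simp add: power_add mult_ac)
  have sumC: "summable (\<lambda>j. prob (C j))"
    by (rule summable_comparison_test'[OF sums_summable[OF geo]]) (use probC in auto)
  have "prob (\<Union>j. C j) \<le> (\<Sum>j. prob (C j))"
    by (intro finite_measure_subadditive_countably sumC) auto
  also have "\<dots> \<le> 2 ^ (n\<^sub>0 + 3) * exp (- K\<^sup>2)"
    using suminf_le[OF probC sumC sums_summable[OF geo]] sums_unique[OF geo] by simp
  finally have C: "prob (\<Union>j. C j) \<le> 2 ^ (n\<^sub>0 + 3) * exp (- K\<^sup>2)" .
  have "prob (\<Union>k\<le>2 ^ n\<^sub>0. B k) \<le> (\<Sum>k\<le>2 ^ n\<^sub>0. prob (B k))"
    by (intro finite_measure_subadditive_finite) auto
  also have "\<dots> \<le> (\<Sum>k\<le>(2::nat) ^ n\<^sub>0. 2 * exp (- (r / 4 / \<sigma>)\<^sup>2 / 4))"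
    by (intro sum_mono probB) auto
  also have "\<dots> = 2 * (2 ^ n\<^sub>0 + 1) * exp (- (r / 4 / \<sigma>)\<^sup>2 / 4)" by (simp add: algebra_simps)
  finally have B: "prob (\<Union>k\<le>2 ^ n\<^sub>0. B k) \<le> 2 * (2 ^ n\<^sub>0 + 1) * exp (- (r / 4 / \<sigma>)\<^sup>2 / 4)" .
  have A: "exp (- 2) * (\<delta> / (3 * s * m)) ^ m - exp (- (r / (4 * \<Lambda>) / \<delta>)\<^sup>2 / 2) \<le> prob A"
    unfolding A_def using X var m s \<delta> r \<Lambda> by (intro small_ball_lower_bound) auto
  have "A \<subseteq> G \<union> ((\<Union>k\<le>2 ^ n\<^sub>0. B k) \<union> (\<Union>j. C j))"
  proof
    fix \<omega> assume \<omega>A: "\<omega> \<in> A"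
    then have \<omega>: "\<omega> \<in> space M" by (simp add: A_def)
    have "\<omega> \<in> G" if notB: "\<omega> \<notin> (\<Union>k\<le>2 ^ n\<^sub>0. B k)" and notC: "\<omega> \<notin> (\<Union>j. C j)"
      unfolding G_def
    proof (intro CollectI conjI ballI \<omega>)
      fix t assume t: "t \<in> {0..T}"
      have "\<bar>X t \<omega>\<bar> \<le> r / 2 + (r / 8) / (1 - 3/4)"
      proof (rule dyadic_chaining[OF cont[OF \<omega>] T t])
        fix k :: nat assume k: "k \<le> 2 ^ n\<^sub>0"
        let ?t = "grid n\<^sub>0 k"
        have "\<bar>\<Sum>j<m. w ?t j * X (node j) \<omega>\<bar> \<le> (\<Sum>j<m. \<bar>w ?t j\<bar> * \<bar>X (node j) \<omega>\<bar>)"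
          by (intro order_trans[OF sum_abs]) (simp add: abs_mult)
        also have "\<dots> \<le> (\<Sum>j<m. \<bar>w ?t j\<bar> * (r / (4 * \<Lambda>)))"
          using \<omega>A by (intro sum_mono mult_left_mono) (auto simp: A_def)
        also have "\<dots> \<le> \<Lambda> * (r / (4 * \<Lambda>))"
          unfolding sum_distrib_right[symmetric] using weights[OF grid[OF k]] r \<Lambda>
          by (intro mult_right_mono) auto
        also have "\<dots> = r / 4" using \<Lambda> by simp
        finally have "\<bar>\<Sum>j<m. w ?t j * X (node j) \<omega>\<bar> \<le> r / 4" .
        moreover have "\<bar>R ?t \<omega>\<bar> \<le> r / 4" using notB k \<omega> by (auto simp: B_def not_less)
        ultimately show "\<bar>X (real k * T / 2 ^ n\<^sub>0) \<omega>\<bar> \<le> r / 2"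
          unfolding R_def grid_def by linarith
      next
        fix j k :: nat assume k: "k < 2 ^ (n\<^sub>0 + Suc j)"
        have "\<omega> \<notin> D j k" using notC k by (auto simp: C_def)
        then show "\<bar>X (real (Suc k) * T / 2 ^ (n\<^sub>0 + Suc j)) \<omega> - X (real k * T / 2 ^ (n\<^sub>0 + Suc j)) \<omega>\<bar>
            \<le> r / 8 * (3/4) ^ j"
          using \<omega> unfolding D_def grid_def by (simp add: not_less)
      qed (use r in auto)
      then show "\<bar>X t \<omega>\<bar> \<le> r" by simp
    qed
    then show "\<omega> \<in> G \<union> ((\<Union>k\<le>2 ^ n\<^sub>0. B k) \<union> (\<Union>j. C j))" by blast
  qed
  then have "prob A \<le> prob (G \<union> ((\<Union>k\<le>2 ^ n\<^sub>0. B k) \<union> (\<Union>j. C j)))"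
    by (intro finite_measure_mono) auto
  also have "\<dots> \<le> prob G + (prob (\<Union>k\<le>2 ^ n\<^sub>0. B k) + prob (\<Union>j. C j))"
    by (intro order_trans[OF measure_Un_le] add_left_mono measure_Un_le) auto
  finally show ?thesis using A B C unfolding G_def by linarith
qed

section \<open>Piecewise interpolation\<close>

text \<open>The index \<open>i = k * N + j\<close> encodes block \<open>k\<close> and local node
  \<open>j\<close>. Interpolation weights vanish outside one block, and this collapses sums over all
  nodes to that block.\<close>

lemma sum_over_block:
  fixes g :: "nat \<Rightarrow> 'b::comm_monoid_add"
  assumes "k < K"
  shows "(\<Sum>i<N * K. if i div N = k then g i else 0) = (\<Sum>j<N. g (k * N + j))"
proof -
  have "(\<Sum>i<N * K. if i div N = k then g i else 0) = sum g {i. i < N * K \<and> i div N = k}"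
    by (simp add: sum.inter_filter[symmetric] lessThan_def[symmetric] Int_def)
  also have "\<dots> = (\<Sum>j<N. g (k * N + j))"
  proof (rule sum.reindex_bij_witness[of _ "\<lambda>j. k * N + j" "\<lambda>i. i mod N"])
    fix i assume i: "i \<in> {i. i < N * K \<and> i div N = k}"
    then show "k * N + i mod N = i" by auto
    then show "g (k * N + i mod N) = g i" by simp
    have "N > 0" using i by (auto intro!: Nat.gr0I)
    then show "i mod N \<in> {..<N}" by simp
  next
    fix j assume j: "j \<in> {..<N}"
    have "k * N + j < (k + 1) * N" using j by simp
    also have "\<dots> \<le> K * N" using assms by (intro mult_right_mono) auto
    finally show "k * N + j \<in> {i. i < N * K \<and> i div N = k}"
      using j by (simp add: mult.commute)
  qed auto
  finally show ?thesis .
qed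

text \<open>The evaluation point joins the nodes as index \<open>m\<close> with coefficient 1, so
  the spectral isometry applies to the residual as one linear combination.\<close>

lemma variance_residual:
  fixes m :: nat and w :: "nat \<Rightarrow> real"
  assumes "gaussian_process M X" "centered M X" "has_spectral_measure M X F"
  shows "(LINT \<omega>|M. (X t \<omega> - (\<Sum>i<m. w i * X (node i) \<omega>))\<^sup>2)
    = (LINT u|F. (cmod (iexp (t * u) - (\<Sum>i<m. w i * iexp (node i * u))))\<^sup>2)"
proof -
  define b where "b i = (if i < m then - w i else 1)" for i
  define \<tau> where "\<tau> i = (if i < m then node i else t)" for i
  have "(LINT \<omega>|M. (\<Sum>i\<in>{..<Suc m}. b i * X (\<tau> i) \<omega>)\<^sup>2)
      = (LINT u|F. (cmod (\<Sum>i\<in>{..<Suc m}. b i * iexp (\<tau> i * u)))\<^sup>2)"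
    by (rule variance_spectral[OF assms]) simp
  moreover have "(\<Sum>i\<in>{..<Suc m}. b i * X (\<tau> i) \<omega>) = X t \<omega> - (\<Sum>i<m. w i * X (node i) \<omega>)" for \<omega>
    by (simp add: b_def \<tau>_def sum_negf)
  moreover have "(\<Sum>i\<in>{..<Suc m}. b i * iexp (\<tau> i * u)) = iexp (t * u) - (\<Sum>i<m. w i * iexp (node i * u))" for u
    by (simp add: b_def \<tau>_def sum_negf)
  ultimately show ?thesis by simp
qed

text \<open>Interpolation with \<open>N\<close> nodes on each of \<open>K\<close> subintervals of \<open>[0, T]\<close>.\<close>
lemma piecewise_interpolation:
  fixes T :: real
  assumes "0 < T" "1 \<le> N" "1 \<le> K"
    and "gaussian_process M X" "centered M X" "has_spectral_measure M X F"
    and int: "integrable F (\<lambda>u. u ^ (2 * N))"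
  shows "\<exists>(node :: nat \<Rightarrow> real) w. \<forall>t\<in>{0..T}. (\<Sum>i<N * K. \<bar>w t i\<bar>) \<le> 6 ^ N \<and>
    (LINT \<omega>|M. (X t \<omega> - (\<Sum>i<N * K. w t i * X (node i) \<omega>))\<^sup>2)
      \<le> (36 * T / (N * K)) ^ (2 * N) * (LINT u|F. u ^ (2 * N))"
proof -
  define h where "h = T / (N * K)"
  \<comment> \<open>The minimum assigns the right endpoint \<open>T\<close> to the last block; the
    floor alone would give the nonexistent block \<open>K\<close>.\<close>
  define piece where "piece t = min (K - 1) (nat \<lfloor>t / (N * h)\<rfloor>)" for t
  define y where "y t = t / h - N * piece t" for t
  define node where "node i = h * real i" for i
  define w where "w t i = (if i div N = piece t then lagrange N (i mod N) (y t) else 0)" for t i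
  have h: "0 < h" using assms by (simp add: h_def)
  have piece: "piece t < K" for t using assms by (simp add: piece_def)
  have y: "0 \<le> y t" "y t \<le> N" if t: "t \<in> {0..T}" for t
  proof -
    define z where "z = t / (N * h)"
    have z: "0 \<le> z" "z \<le> K" "t / h = N * z" using t h assms by (auto simp: z_def h_def field_simps)
    have fl: "real (nat \<lfloor>z\<rfloor>) \<le> z" "z \<le> real (nat \<lfloor>z\<rfloor>) + 1" using z by linarith+
    have p: "piece t = min (K - 1) (nat \<lfloor>z\<rfloor>)" by (simp add: piece_def z_def)
    have "real (piece t) \<le> real (nat \<lfloor>z\<rfloor>)" unfolding p by linarith
    then have "real (piece t) \<le> z" using fl by linarith
    moreover have "z \<le> real (piece t) + 1"
      using fl z assms unfolding p by (cases "K - 1 \<le> nat \<lfloor>z\<rfloor>") (auto simp: min_def of_nat_diff)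
    ultimately have "real (piece t) \<le> z" "z \<le> real (piece t) + 1" .
    then have "real N * real (piece t) \<le> real N * z" "real N * z \<le> real N * (real (piece t) + 1)"
      by (auto intro: mult_left_mono)
    then show "0 \<le> y t" "y t \<le> N" unfolding y_def z by (auto simp: algebra_simps)
  qed
  \<comment> \<open>Stated for a general \<open>f\<close> vanishing at weight 0 because it serves
    twice: for the real sum of absolute weights and for the complex sum of exponentials.\<close>
  have block: "(\<Sum>i<N * K. f (w t i) i) = (\<Sum>j<N. f (lagrange N j (y t)) (piece t * N + j))"
    if "\<And>i. f 0 i = 0" for f :: "real \<Rightarrow> nat \<Rightarrow> 'c::comm_monoid_add" and t
  proof -
    have "(\<Sum>i<N * K. f (w t i) i)
        = (\<Sum>i<N * K. if i div N = piece t then f (lagrange N (i mod N) (y t)) i else 0)"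
      by (intro sum.cong) (auto simp: w_def that)
    also have "\<dots> = (\<Sum>j<N. f (lagrange N ((piece t * N + j) mod N) (y t)) (piece t * N + j))"
      by (rule sum_over_block[OF piece])
    finally show ?thesis by simp
  qed
  have weights: "(\<Sum>i<N * K. \<bar>w t i\<bar>) \<le> 6 ^ N" if "t \<in> {0..T}" for t
    using block[of "\<lambda>x i. \<bar>x\<bar>" t] lagrange_abs_sum[OF y[OF that] assms(2)] by simp
  have "(LINT \<omega>|M. (X t \<omega> - (\<Sum>i<N * K. w t i * X (node i) \<omega>))\<^sup>2)
      \<le> (36 * T / (N * K)) ^ (2 * N) * (LINT u|F. u ^ (2 * N))" if t: "t \<in> {0..T}" for t
  proof -
    have err: "(cmod (iexp (t * u) - (\<Sum>i<N * K. w t i * iexp (node i * u))))\<^sup>2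
        \<le> (36 * T / (N * K)) ^ (2 * N) * u ^ (2 * N)" for u
    proof -
      \<comment> \<open>Moving the left end of the block to 0 only multiplies all exponentials by a
        common factor of modulus 1; what is left is the integer-node case at frequency
        \<open>h * u\<close>.\<close>
      let ?e = "iexp (h * (N * piece t) * u)"
      have shift: "iexp (x * u) = ?e * iexp ((x / h - N * piece t) * (h * u))" for x
        using h by (simp add: exp_add[symmetric] field_simps)
      have "(\<Sum>i<N * K. w t i * iexp (node i * u))
          = (\<Sum>j<N. lagrange N j (y t) * iexp (node (piece t * N + j) * u))"
        by (rule block) simp
      also have "\<dots> = ?e * (\<Sum>j<N. lagrange N j (y t) * iexp (real j * (h * u)))"
        unfolding sum_distrib_left
      proof (intro sum.cong refl)
        fix j
        have "node (piece t * N + j) / h - N * piece t = real j" using h by (simp add: node_def)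
        then show "lagrange N j (y t) * iexp (node (piece t * N + j) * u)
            = ?e * (lagrange N j (y t) * iexp (real j * (h * u)))"
          unfolding shift[of "node (piece t * N + j)"] by (simp only: mult_ac)
      qed
      finally have "iexp (t * u) - (\<Sum>i<N * K. w t i * iexp (node i * u))
          = ?e * (iexp (y t * (h * u)) - (\<Sum>j<N. lagrange N j (y t) * iexp (real j * (h * u))))"
        unfolding shift[of t] y_def[symmetric] by (simp only: right_diff_distrib)
      then have "cmod (iexp (t * u) - (\<Sum>i<N * K. w t i * iexp (node i * u))) \<le> (36 * \<bar>h * u\<bar>) ^ N"
        using lagrange_iexp_error[OF y[OF t] assms(2), of "h * u"] by (simp add: norm_mult)
      then have "(cmod (iexp (t * u) - (\<Sum>i<N * K. w t i * iexp (node i * u))))\<^sup>2 \<le> ((36 * \<bar>h * u\<bar>) ^ N)\<^sup>2"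
        by (intro power_mono) auto
      also have "\<dots> = \<bar>36 * h * u\<bar> ^ (2 * N)" using h by (simp add: power_mult[symmetric] abs_mult mult_ac)
      also have "\<dots> = (36 * h) ^ (2 * N) * u ^ (2 * N)"
        unfolding power_mult power2_abs by (simp add: power_mult_distrib)
      finally show ?thesis by (simp add: h_def)
    qed
    interpret F: finite_measure F using assms by (simp add: has_spectral_measure_def)
    have [measurable_cong]: "sets F = sets borel" using assms by (simp add: has_spectral_measure_def)
    have "(LINT \<omega>|M. (X t \<omega> - (\<Sum>i<N * K. w t i * X (node i) \<omega>))\<^sup>2)
        = (LINT u|F. (cmod (iexp (t * u) - (\<Sum>i<N * K. w t i * iexp (node i * u))))\<^sup>2)"
      by (rule variance_residual[OF assms(4-6)])
    also have "\<dots> \<le> (LINT u|F. (36 * T / (N * K)) ^ (2 * N) * u ^ (2 * N))"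
    proof (rule integral_mono[OF _ _ err])
      show "integrable F (\<lambda>u. (cmod (iexp (t * u) - (\<Sum>i<N * K. w t i * iexp (node i * u))))\<^sup>2)"
        by (rule Bochner_Integration.integrable_bound[OF integrable_mult_right[OF int, of "(36 * T / (N * K)) ^ (2 * N)"]])
           (use err in \<open>auto intro: order_trans[OF _ abs_ge_self]\<close>)
    qed (use int in auto)
    finally show ?thesis by simp
  qed
  then show ?thesis using weights by blast
qed

section \<open>Choice of parameters and the probability bound for small r\<close>

lemma power2_bracket:
  fixes x :: real
  assumes "1 \<le> x"
  obtains n :: nat where "x \<le> 2 ^ n" "2 ^ n \<le> 2 * x"
proof -
  define n where "n = (LEAST n. x \<le> (2::real) ^ n)"
  have "\<exists>n. x \<le> (2::real) ^ n" using real_arch_pow[of 2 x] by (auto intro: less_imp_le)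
  then have "x \<le> 2 ^ n" unfolding n_def by (rule LeastI_ex)
  moreover have "2 ^ n \<le> 2 * x"
  proof (cases n)
    case 0
    then show ?thesis using assms by simp
  next
    case (Suc k)
    then have "\<not> x \<le> 2 ^ k" using not_less_Least[of k "\<lambda>n. x \<le> (2::real) ^ n"] by (simp add: n_def)
    then show ?thesis using Suc by simp
  qed
  ultimately show thesis by (rule that)
qed

lemma cmod_iexp_diff_le: "cmod (iexp (t * u) - iexp (t' * u)) \<le> \<bar>(t - t') * u\<bar>"
proof -
  have "iexp (t * u) - iexp (t' * u) = iexp (t' * u) * (iexp ((t - t') * u) - 1)"
    by (simp add: exp_add[symmetric] algebra_simps)
  then have "cmod (iexp (t * u) - iexp (t' * u)) = cmod (iexp ((t - t') * u) - 1)"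
    by (simp add: norm_mult)
  also have "\<dots> \<le> \<bar>(t - t') * u\<bar>" using iexp_approx1[of "(t - t') * u" 0] by simp
  finally show ?thesis .
qed

lemma
  assumes "gaussian_process M X" "centered M X" "has_spectral_measure M X F"
  shows variance_eq_mass: "(LINT \<omega>|M. (X t \<omega>)\<^sup>2) = measure F (space F)"
    and increment_variance_le: "integrable F (\<lambda>u. u\<^sup>2) \<Longrightarrow>
      (LINT \<omega>|M. (X t \<omega> - X t' \<omega>)\<^sup>2) \<le> (t - t')\<^sup>2 * (LINT u|F. u\<^sup>2)"
proof -
  interpret F: finite_measure F using assms by (simp add: has_spectral_measure_def)
  have [measurable_cong]: "sets F = sets borel" using assms by (simp add: has_spectral_measure_def)
  show "(LINT \<omega>|M. (X t \<omega>)\<^sup>2) = measure F (space F)"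
    using variance_residual[OF assms, where t = t and m = 0] by simp
  assume int: "integrable F (\<lambda>u. u\<^sup>2)"
  have le: "(cmod (iexp (t * u) - iexp (t' * u)))\<^sup>2 \<le> (t - t')\<^sup>2 * u\<^sup>2" for u
    using power_mono[OF cmod_iexp_diff_le norm_ge_zero, of t u t' 2] by (simp add: power_mult_distrib)
  have "(LINT \<omega>|M. (X t \<omega> - X t' \<omega>)\<^sup>2) = (LINT u|F. (cmod (iexp (t * u) - iexp (t' * u)))\<^sup>2)"
    using variance_residual[OF assms, where t = t and m = 1 and w = "\<lambda>_. 1" and node = "\<lambda>_. t'"] by simp
  also have "\<dots> \<le> (LINT u|F. (t - t')\<^sup>2 * u\<^sup>2)"
  proof (rule integral_mono[OF _ _ le])
    show "integrable F (\<lambda>u. (cmod (iexp (t * u) - iexp (t' * u)))\<^sup>2)"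
      by (rule Bochner_Integration.integrable_bound[OF integrable_mult_right[OF int, of "(t - t')\<^sup>2"]])
         (use le in \<open>auto intro: order_trans[OF _ abs_ge_self]\<close>)
  qed (use int in auto)
  finally show "(LINT \<omega>|M. (X t \<omega> - X t' \<omega>)\<^sup>2) \<le> (t - t')\<^sup>2 * (LINT u|F. u\<^sup>2)" by simp
qed

text \<open>From \<open>exp 1 \<ge> 5/2\<close> one gets \<open>exp 2 \<ge> 25/4\<close>, which
  exceeds 6. Hence the weights, despite growing exponentially in \<open>N\<close>, cost only a fixed
  power of \<open>r\<close>.\<close>

lemma six_power_le:
  fixes r :: real
  assumes "0 < r" "real N \<le> 5 * (- ln r)"
  shows "6 ^ N \<le> 1 / r ^ 10"
proof -
  have "(5/2)\<^sup>2 \<le> (exp (1::real))\<^sup>2"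
    using exp_lower_Taylor_quadratic[of "1::real"] by (intro power_mono) auto
  also have "\<dots> = exp 2" by (simp add: exp_double[symmetric])
  finally have "(6::real) \<le> exp 2" by (simp add: power2_eq_square)
  then have "(6::real) ^ N \<le> exp 2 ^ N" by (intro power_mono) auto
  also have "\<dots> = exp (2 * real N)" by (simp add: exp_of_nat_mult[symmetric] mult.commute)
  also have "\<dots> \<le> exp (- (real 10 * ln r))" using assms by simp
  also have "\<dots> = 1 / r ^ 10"
    using assms unfolding exp_minus exp_of_nat_mult by (simp add: inverse_eq_divide)
  finally show ?thesis .
qed

text \<open>\<open>N\<close> and \<open>K\<close> are quantified inside the filter because they will
  be chosen depending on \<open>r\<close>; the estimates must hold uniformly over all admissible
  pairs. The last condition on them says that the interpolation error has standard deviation of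
  order \<open>r ^ 4\<close>.\<close>

lemma small_ball_probability:
  fixes M :: "'a measure" and X :: "real \<Rightarrow> 'a \<Rightarrow> real"
  assumes \<nu>: "0 < \<nu>" and T: "0 < T"
    and proc: "gaussian_process M X" "centered M X" "has_spectral_measure M X (spectral_F \<nu>)"
    and cont: "continuous_paths M X"
  shows "\<forall>\<^sub>F r in at_right 0. \<forall>N K. 1 \<le> N \<longrightarrow> 1 \<le> K \<longrightarrow> real N \<le> 5 * (- ln r) \<longrightarrow>
      real (N * K) \<le> r powr (-1/2) \<longrightarrow>
      (36 * T / real (N * K) * (4 * real N / \<nu>) powr (1 / \<nu>)) ^ N \<le> r ^ 4 \<longrightarrow>
      exp (14 * real (N * K) * ln r) \<le> measure M {\<omega>\<in>space M. \<forall>t\<in>{0..T}. \<bar>X t \<omega>\<bar> \<le> r}"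
proof -
  interpret gaussian_space M "lin_combs X" using proc by (intro gaussian_space_lin_combs)
  define F where "F = spectral_F \<nu>"
  have specF: "has_spectral_measure M X F" using proc by (simp add: F_def)
  interpret F: finite_measure F using specF by (simp add: has_spectral_measure_def)
  obtain C where C: "C > 0" "\<And>N. N \<ge> 1 \<Longrightarrow> integrable F (\<lambda>u. u ^ (2 * N))"
    "\<And>N. N \<ge> 1 \<Longrightarrow> (LINT u|F. u ^ (2 * N)) \<le> C * (4 * real N / \<nu>) powr (2 * real N / \<nu>)"
    using spectral_F_moments[OF \<nu> F.finite_measure_axioms[unfolded F_def]] unfolding F_def by metis
  define S where "S = sqrt C"
  \<comment> \<open>The summands 1 here and in \<open>V\<close> give \<open>s \<ge> 1\<close> and
    \<open>V > 0\<close>, and they let \<open>s\<^sup>2\<close> dominate the variance, which is the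
    mass of \<open>F\<close>.\<close>
  define s where "s = 1 + measure F (space F)"
  define V where "V = 1 + sqrt (LINT u|F. u\<^sup>2)"
  have S: "0 < S" using C by (simp add: S_def)
  have s: "1 \<le> s" by (simp add: s_def)
  have m2: "0 \<le> (LINT u|F. u\<^sup>2)" by simp
  have V: "0 < V" using m2 by (simp add: V_def add_pos_nonneg)
  define W where "W = V * T"
  have W: "W > 0" using V T by (simp add: W_def)
  have var: "expectation (\<lambda>\<omega>. (X t \<omega>)\<^sup>2) \<le> s\<^sup>2" for t
  proof -
    have "measure F (space F) \<le> s * 1" by (simp add: s_def)
    also have "\<dots> \<le> s * s" using s by (intro mult_left_mono) auto
    finally show ?thesis unfolding variance_eq_mass[OF proc(1,2) specF] by (simp add: power2_eq_square)
  qed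
  have incr: "expectation (\<lambda>\<omega>. (X t \<omega> - X t' \<omega>)\<^sup>2) \<le> (V * (t - t'))\<^sup>2" for t t'
  proof -
    have "integrable F (\<lambda>u. u\<^sup>2)" using C(2)[of 1] by simp
    then have "expectation (\<lambda>\<omega>. (X t \<omega> - X t' \<omega>)\<^sup>2) \<le> (t - t')\<^sup>2 * (LINT u|F. u\<^sup>2)"
      by (rule increment_variance_le[OF proc(1,2) specF])
    also have "(t - t')\<^sup>2 * (LINT u|F. u\<^sup>2) = (t - t')\<^sup>2 * (sqrt (LINT u|F. u\<^sup>2))\<^sup>2" using m2 by simp
    also have "\<dots> \<le> (t - t')\<^sup>2 * V\<^sup>2"
      using m2 unfolding V_def by (intro mult_left_mono power_mono) auto
    finally show ?thesis by (simp add: power_mult_distrib mult.commute)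
  qed
  \<comment> \<open>A lower bound for the main term that is uniform in
    \<open>N * K \<le> r powr (-1/2)\<close>, so the errors can be compared without mentioning
    \<open>N\<close> and \<open>K\<close>. Each of the three errors gets one sixth, and half of the
    main term survives.\<close>
  define H where "H r = exp (- 2 + 13 * r powr (-1/2) * ln r)" for r :: real
  have "\<forall>\<^sub>F r in at_right 0. 3 * s \<le> r powr (-1/2)" by real_asymp
  moreover have "\<forall>\<^sub>F r in at_right 0. exp (- (1 / (4 * r))\<^sup>2 / 2) \<le> 1 / 6 * H r"
    unfolding H_def by real_asymp
  moreover have "\<forall>\<^sub>F r in at_right 0.
      2 * (2 / r ^ 4 + 1) * exp (- (1 / (4 * S * r ^ 3))\<^sup>2 / 4) \<le> 1 / 6 * H r"
    unfolding H_def using S by real_asymp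
  moreover have "\<forall>\<^sub>F r in at_right 0. 16 / r ^ 4 * exp (- (1 / (8 * W * r ^ 3))\<^sup>2) \<le> 1 / 6 * H r"
    unfolding H_def using W by real_asymp
  moreover have "\<forall>\<^sub>F r in at_right 0. exp (- (1 / (8 * W * r ^ 3))\<^sup>2) \<le> 1 / 4"
    using W by real_asymp
  moreover have "\<forall>\<^sub>F r in at_right (0::real). 3 \<le> - ln r" by real_asymp
  moreover have "\<forall>\<^sub>F r in at_right (0::real). 0 < r \<and> r < 1"
    by (intro eventually_conj) (real_asymp+)
  ultimately show ?thesis
  proof eventually_elim
    case (elim r)
    note ev = elim(1-6)
    have r: "0 < r" "r < 1" using elim by auto
    show ?case
    proof (intro allI impI)
      fix N K :: nat
      assume N: "1 \<le> N" and K: "1 \<le> K" and NL: "real N \<le> 5 * (- ln r)"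
        and NK: "real (N * K) \<le> r powr (-1/2)"
        and small: "(36 * T / real (N * K) * (4 * real N / \<nu>) powr (1 / \<nu>)) ^ N \<le> r ^ 4"
      define m where "m = N * K"
      have m: "1 \<le> m" using N K by (simp add: m_def)
      obtain node w where nw: "\<forall>t\<in>{0..T}. (\<Sum>i<m. \<bar>w t i\<bar>) \<le> 6 ^ N \<and>
          expectation (\<lambda>\<omega>. (X t \<omega> - (\<Sum>i<m. w t i * X (node i) \<omega>))\<^sup>2)
          \<le> (36 * T / m) ^ (2 * N) * (LINT u|F. u ^ (2 * N))"
        using piecewise_interpolation[OF T N K proc(1,2) specF C(2)[OF N], folded m_def] by blast
      have approx: "expectation (\<lambda>\<omega>. (X t \<omega> - (\<Sum>i<m. w t i * X (node i) \<omega>))\<^sup>2) \<le> (S * r ^ 4)\<^sup>2"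
        if "t \<in> {0..T}" for t
      proof -
        have "expectation (\<lambda>\<omega>. (X t \<omega> - (\<Sum>i<m. w t i * X (node i) \<omega>))\<^sup>2)
            \<le> (36 * T / m) ^ (2 * N) * (C * (4 * real N / \<nu>) powr (2 * real N / \<nu>))"
          using C(3)[OF N] by (intro order_trans[OF conjunct2[OF bspec[OF nw that]] mult_left_mono]) (auto simp: power_mult)
        also have "(4 * real N / \<nu>) powr (2 * real N / \<nu>) = ((4 * real N / \<nu>) powr (1 / \<nu>)) ^ (2 * N)"
          using N \<nu> by (subst powr_realpow[symmetric]) (auto simp: powr_powr)
        also have "(36 * T / m) ^ (2 * N) * (C * ((4 * real N / \<nu>) powr (1 / \<nu>)) ^ (2 * N))
            = C * ((36 * T / m * (4 * real N / \<nu>) powr (1 / \<nu>)) ^ N)\<^sup>2"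
          by (simp add: power_mult_distrib power_mult[symmetric] power_divide mult.commute)
        also have "\<dots> \<le> C * (r ^ 4)\<^sup>2"
          using small C(1) T r unfolding m_def by (intro mult_left_mono power_mono zero_le_power) auto
        also have "\<dots> = (S * r ^ 4)\<^sup>2" using C by (simp add: S_def power_mult_distrib)
        finally show ?thesis .
      qed
      \<comment> \<open>At this level the chaining constant is at least of order
        \<open>r * (1 / r ^ 4) = 1 / r ^ 3\<close>, so its error is negligible, while the union
        bound still runs over only O(\<open>1 / r ^ 4\<close>) grid points.\<close>
      obtain n\<^sub>0 :: nat where n0: "1 / r ^ 4 \<le> 2 ^ n\<^sub>0" "2 ^ n\<^sub>0 \<le> 2 * (1 / r ^ 4)"
      proof (rule power2_bracket)
        show "1 \<le> 1 / r ^ 4" using r by (simp add: power_le_one)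
      qed
      define J where "J = r * 2 ^ n\<^sub>0 / (8 * V * T)"
      have "1 / (8 * W * r ^ 3) = r * (1 / r ^ 4) / (8 * V * T)"
        using r unfolding W_def by (simp add: power_eq_if field_simps)
      also have "\<dots> \<le> J" unfolding J_def using n0 r V T by (intro divide_right_mono mult_left_mono) auto
      finally have "(1 / (8 * W * r ^ 3))\<^sup>2 \<le> J\<^sup>2" using W r by (intro power_mono) auto
      then have J: "exp (- J\<^sup>2) \<le> exp (- (1 / (8 * W * r ^ 3))\<^sup>2)" by simp
      \<comment> \<open>With weights bounded by \<open>1 / r ^ 10\<close> the node values have to
        stay below \<open>r ^ 11 / 4\<close>. The scale \<open>\<delta> = r ^ 12\<close> is smaller
        by the factor \<open>4 * r\<close>, which makes the first error
        \<open>exp (- (1 / (4 * r))\<^sup>2 / 2)\<close>.\<close>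
      have bound: "exp (- 2) * (r ^ 12 / (3 * s * m)) ^ m - exp (- (r / (4 * (1 / r ^ 10)) / r ^ 12)\<^sup>2 / 2)
          - 2 * (2 ^ n\<^sub>0 + 1) * exp (- (r / 4 / (S * r ^ 4))\<^sup>2 / 4) - 2 ^ (n\<^sub>0 + 3) * exp (- J\<^sup>2)
        \<le> prob {\<omega>\<in>space M. \<forall>t\<in>{0..T}. \<bar>X t \<omega>\<bar> \<le> r}"
      proof (rule sup_lower_bound[where V = V and node = node and w = w])
        show "X t \<in> lin_combs X" for t by (rule lin_combs_single)
        show "continuous_on UNIV (\<lambda>t. X t \<omega>)" if "\<omega> \<in> space M" for \<omega>
          using cont that by (simp add: continuous_paths_def)
        show "(\<Sum>i<m. \<bar>w t i\<bar>) \<le> 1 / r ^ 10" if "t \<in> {0..T}" for t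
          using bspec[OF nw that] six_power_le[OF r(1) NL] by linarith
        show "exp (- J\<^sup>2) \<le> 1 / 4" using J ev(5) by linarith
        show "r ^ 12 \<le> 1" using r by (simp add: power_le_one)
      qed (use T r S V s var incr approx m in \<open>auto simp: J_def\<close>)
      let ?E = "exp (- 2 + 13 * real m * ln r)"
      have lnr: "ln r < 0" using r by simp
      have HE: "H r \<le> ?E"
        using NK lnr unfolding H_def m_def[symmetric] by (simp add: mult_right_mono_neg)
      have "r / (4 * (1 / r ^ 10)) / r ^ 12 = 1 / (4 * r)"
        using r by (simp add: power_eq_if field_simps)
      then have err1: "exp (- (r / (4 * (1 / r ^ 10)) / r ^ 12)\<^sup>2 / 2) \<le> 1 / 6 * ?E"
        using ev(2) HE by simp
      have eq2: "r / 4 / (S * r ^ 4) = 1 / (4 * S * r ^ 3)"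
        using r S by (simp add: power_eq_if field_simps)
      have "2 * (2 ^ n\<^sub>0 + 1) * exp (- (r / 4 / (S * r ^ 4))\<^sup>2 / 4)
          \<le> 2 * (2 / r ^ 4 + 1) * exp (- (1 / (4 * S * r ^ 3))\<^sup>2 / 4)"
        unfolding eq2 using n0 by (intro mult_right_mono mult_left_mono add_right_mono) auto
      then have err2: "2 * (2 ^ n\<^sub>0 + 1) * exp (- (r / 4 / (S * r ^ 4))\<^sup>2 / 4) \<le> 1 / 6 * ?E"
        using ev(3) HE by linarith
      have "2 ^ (n\<^sub>0 + 3) * exp (- J\<^sup>2) \<le> 16 / r ^ 4 * exp (- (1 / (8 * W * r ^ 3))\<^sup>2)"
        using n0 J r by (intro mult_mono) (auto simp: power_add)
      then have err3: "2 ^ (n\<^sub>0 + 3) * exp (- J\<^sup>2) \<le> 1 / 6 * ?E"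
        using ev(4) HE by linarith
      \<comment> \<open>Both \<open>3 * s\<close> and \<open>m\<close> are at most
        \<open>r powr (-1/2)\<close>, so dividing by \<open>3 * s * m\<close> costs one more power
        of \<open>r\<close>: from 12 to 13.\<close>
      have main: "?E \<le> exp (- 2) * (r ^ 12 / (3 * s * m)) ^ m"
      proof -
        have "3 * s * m \<le> r powr (-1/2) * r powr (-1/2)"
          using ev(1) NK s unfolding m_def by (intro mult_mono) auto
        also have "\<dots> = 1 / r" using r by (simp add: powr_add[symmetric] powr_minus_divide)
        finally have "3 * s * m * r \<le> 1" using r by (simp add: field_simps)
        then have "r ^ 13 \<le> r ^ 12 / (3 * s * m)"
          using r s m mult_left_mono[of "3 * s * m * r" 1 "r ^ 12"]
          by (simp add: pos_le_divide_eq power_eq_if mult_ac)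
        then have "(r ^ 13) ^ m \<le> (r ^ 12 / (3 * s * m)) ^ m" using r by (intro power_mono) auto
        moreover have "(r ^ 13) ^ m = exp (13 * real m * ln r)"
        proof -
          have "(r ^ 13) ^ m = exp (real (13 * m) * ln r)"
            using r unfolding exp_of_nat_mult by (simp add: power_mult)
          then show ?thesis by simp
        qed
        ultimately show ?thesis unfolding exp_add by (intro mult_left_mono) auto
      qed
      \<comment> \<open>The fourteenth power pays for the constants:
        \<open>m * ln r \<le> - 3\<close> covers the factor \<open>exp (- 2)\<close> and leaves
        \<open>exp (- 1)\<close>, which is below one half.\<close>
      have "exp (14 * real m * ln r) \<le> exp (- 1) * ?E"
      proof -
        have "real m * ln r \<le> 1 * ln r" using m lnr by (intro mult_right_mono_neg) auto
        then have "real m * ln r \<le> - 3" using ev(6) by linarith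
        then show ?thesis by (simp add: exp_add[symmetric])
      qed
      also have "\<dots> \<le> 1 / 2 * ?E"
        using exp_ge_add_one_self[of "1::real"]
        by (intro mult_right_mono) (auto simp: exp_minus field_simps)
      finally show "exp (14 * real (N * K) * ln r) \<le> prob {\<omega>\<in>space M. \<forall>t\<in>{0..T}. \<bar>X t \<omega>\<bar> \<le> r}"
        using bound main err1 err2 err3 unfolding m_def by linarith
    qed
  qed
qed

section \<open>Asymptotics\<close>

text \<open>Compactness of [0, 1] bounds the image, so the real-valued \<open>SUP\<close> is a
  genuine supremum; the time change then stretches the interval to length
  \<open>1 / c\<close>.\<close>

lemma SUP_abs_le_iff:
  fixes f :: "real \<Rightarrow> real"
  assumes "continuous_on UNIV f" "0 < c"
  shows "(SUP t\<in>{0..1}. \<bar>f (t / c)\<bar>) \<le> r \<longleftrightarrow> (\<forall>t\<in>{0..1 / c}. \<bar>f t\<bar> \<le> r)"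
proof -
  have "continuous_on {0..1} (\<lambda>t. \<bar>f (t / c)\<bar>)"
    using assms by (intro continuous_intros continuous_on_compose2[OF assms(1)]) auto
  then have "bdd_above ((\<lambda>t. \<bar>f (t / c)\<bar>) ` {0..1})"
    by (intro bounded_imp_bdd_above compact_imp_bounded compact_continuous_image) auto
  then have "(SUP t\<in>{0..1}. \<bar>f (t / c)\<bar>) \<le> r \<longleftrightarrow> (\<forall>t\<in>{0..1}. \<bar>f (t / c)\<bar> \<le> r)"
    by (intro cSUP_le_iff) auto
  also have "\<dots> \<longleftrightarrow> (\<forall>t\<in>{0..1 / c}. \<bar>f t\<bar> \<le> r)"
  proof (intro iffI ballI)
    fix t :: real assume "\<forall>t\<in>{0..1}. \<bar>f (t / c)\<bar> \<le> r" "t \<in> {0..1 / c}"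
    then show "\<bar>f t\<bar> \<le> r" using assms(2) bspec[of "{0..1}" "\<lambda>t. \<bar>f (t / c)\<bar> \<le> r" "t * c"]
      by (auto simp: field_simps)
  next
    fix t :: real assume "\<forall>t\<in>{0..1 / c}. \<bar>f t\<bar> \<le> r" "t \<in> {0..1}"
    then show "\<bar>f (t / c)\<bar> \<le> r" using assms(2) by (auto simp: divide_right_mono)
  qed
  finally show ?thesis .
qed

text \<open>A lower bound of the form \<open>exp (- x)\<close> is positive and thereby excludes the
  infinite value of \<open>small_dev\<close>.\<close>

lemma small_dev_rescaled_le:
  assumes "continuous_paths M X" "0 < c"
    and "exp (- x) \<le> measure M {\<omega>\<in>space M. \<forall>t\<in>{0..1 / c}. \<bar>X t \<omega>\<bar> \<le> r}"
  shows "small_dev M (rescaled X c) r \<le> ereal x"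
proof -
  define p where "p = measure M {\<omega>\<in>space M. \<forall>t\<in>{0..1 / c}. \<bar>X t \<omega>\<bar> \<le> r}"
  have "{\<omega>\<in>space M. (SUP t\<in>{0..1}. \<bar>rescaled X c t \<omega>\<bar>) \<le> r} = {\<omega>\<in>space M. \<forall>t\<in>{0..1 / c}. \<bar>X t \<omega>\<bar> \<le> r}"
    using assms(1) SUP_abs_le_iff[OF _ assms(2), of "\<lambda>t. X t \<omega>" r for \<omega>]
    unfolding rescaled_def continuous_paths_def by blast
  then have "small_dev M (rescaled X c) r = (if p = 0 then \<infinity> else ereal (- ln p))"
    by (simp add: small_dev_def p_def Let_def)
  moreover have "0 < p" using assms(3) unfolding p_def[symmetric] by (rule less_le_trans[OF exp_gt_zero])
  moreover have "- x \<le> ln p" using assms(3) \<open>0 < p\<close> unfolding p_def[symmetric] by (simp add: ln_ge_iff)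
  ultimately show ?thesis by simp
qed

lemma preceq0_I:
  assumes "\<forall>\<^sub>F r in at_right 0. f r \<le> ereal (C * g r)" "\<forall>\<^sub>F r in at_right 0. 0 < g r"
  shows "preceq0 f g"
proof -
  have "\<forall>\<^sub>F r in at_right 0. f r / ereal (g r) \<le> ereal C"
    using assms
  proof eventually_elim
    case (elim r)
    then have "f r / ereal (g r) \<le> ereal (C * g r) / ereal (g r)" by (intro ereal_divide_right_mono) auto
    also have "\<dots> = ereal C" using elim by simp
    finally show ?case .
  qed
  then have "Limsup (at_right 0) (\<lambda>r. f r / ereal (g r)) \<le> ereal C" by (rule Limsup_bounded)
  then show ?thesis unfolding preceq0_def by (rule le_less_trans) simp
qed

text \<open>Up to the factor \<open>14 * (- ln r)\<close> the small deviation exponent is bounded by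
  the number of nodes, so it remains to make \<open>N * K\<close> small under the interpolation
  condition.\<close>

lemma small_dev_le_node_count:
  fixes M :: "'a measure" and X :: "real \<Rightarrow> 'a \<Rightarrow> real"
  assumes "0 < \<nu>" "0 < c" "gaussian_process M X" "centered M X"
    and "has_spectral_measure M X (spectral_F \<nu>)" "continuous_paths M X"
  shows "\<forall>\<^sub>F r in at_right 0. \<forall>N K. 1 \<le> N \<longrightarrow> 1 \<le> K \<longrightarrow> real N \<le> 5 * (- ln r) \<longrightarrow>
      real (N * K) \<le> r powr (-1/2) \<longrightarrow>
      (36 * (1 / c) / real (N * K) * (4 * real N / \<nu>) powr (1 / \<nu>)) ^ N \<le> r ^ 4 \<longrightarrow>
      small_dev M (rescaled X c) r \<le> ereal (14 * real (N * K) * (- ln r))"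
  using small_ball_probability[of \<nu> "1 / c" M X] assms
  by (auto elim!: eventually_mono intro!: small_dev_rescaled_le)

text \<open>Isolates the power \<open>1 / \<nu> - 1\<close> of \<open>N\<close>, whose sign decides
  whether subdivision is needed.\<close>

lemma interpolation_rate:
  assumes "0 < \<nu>" "1 \<le> N" "1 \<le> K"
  shows "36 * T / real (N * K) * (4 * real N / \<nu>) powr (1 / \<nu>)
    = 36 * T * (4 / \<nu>) powr (1 / \<nu>) * real N powr (1 / \<nu> - 1) / K"
proof -
  have "(4 * real N / \<nu>) powr (1 / \<nu>) = (4 / \<nu>) powr (1 / \<nu>) * real N powr (1 / \<nu>)"
    using assms by (simp add: powr_mult[symmetric])
  moreover have "real N powr (1 / \<nu> - 1) = real N powr (1 / \<nu>) / N"
    using assms by (simp add: powr_diff)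
  ultimately show ?thesis using assms by (simp add: field_simps)
qed

lemma power_le_fourth_power:
  fixes x r :: real
  assumes "0 < r" "0 < x" "4 * (- ln r) \<le> N * (- ln x)"
  shows "x ^ N \<le> r ^ 4"
proof -
  have "x ^ N = exp (N * ln x)" using assms by (simp add: exp_of_nat_mult)
  also have "\<dots> \<le> exp (real 4 * ln r)" using assms by simp
  also have "\<dots> = r ^ 4" using assms(1) unfolding exp_of_nat_mult by simp
  finally show ?thesis .
qed

lemma small_dev_rate_gt_1:
  assumes \<nu>: "1 < \<nu>" and c: "0 < c"
    and proc: "gaussian_process M X" "centered M X" "has_spectral_measure M X (spectral_F \<nu>)"
      "continuous_paths M X"
  shows "preceq0 (small_dev M (rescaled X c)) (\<lambda>r. 1 / c * (\<bar>ln r\<bar>\<^sup>2 / ln \<bar>ln r\<bar>))"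
proof -
  have \<nu>0: "0 < \<nu>" using \<nu> by simp
  define \<kappa> where "\<kappa> = 1 - 1 / \<nu>"
  define D where "D = 36 * (1 / c) * (4 / \<nu>) powr (1 / \<nu>)"
  have \<kappa>: "0 < \<kappa>" using \<nu> by (simp add: \<kappa>_def)
  have D: "0 < D" using c \<nu> by (simp add: D_def)
  \<comment> \<open>With \<open>K = 1\<close> the condition reads
    \<open>N * (\<kappa> * ln N - ln D) \<ge> 4 * (- ln r)\<close>. As \<open>ln (b r)\<close> is
    asymptotic to \<open>ln (- ln r)\<close>, the left side at \<open>b r\<close> is asymptotic to
    \<open>8 * (- ln r)\<close>, twice what is required; the slack absorbs
    \<open>ln D\<close>.\<close>
  define b where "b r = 8 / \<kappa> * (- ln r) / ln (- ln r)" for r :: real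
  have "\<forall>\<^sub>F r in at_right 0. 4 * (- ln r) \<le> b r * (\<kappa> * ln (b r) - ln D)"
    unfolding b_def using \<kappa> by real_asymp
  moreover have "\<forall>\<^sub>F r in at_right 0. b r + 1 \<le> 5 * (- ln r)"
    unfolding b_def using \<kappa> by real_asymp
  moreover have "\<forall>\<^sub>F r in at_right 0. b r + 1 \<le> r powr (-1/2)"
    unfolding b_def using \<kappa> by real_asymp
  moreover have "\<forall>\<^sub>F r in at_right 0. 1 \<le> b r"
    unfolding b_def using \<kappa> by real_asymp
  moreover have "\<forall>\<^sub>F r in at_right 0. 0 \<le> \<kappa> * ln (b r) - ln D"
    unfolding b_def using \<kappa> by real_asymp
  moreover have "\<forall>\<^sub>F r in at_right 0. 0 < r \<and> r < (1::real)"
    by (intro eventually_conj) (real_asymp+)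
  moreover have "\<forall>\<^sub>F r in at_right 0. 0 < ln (- ln (r::real))"
    by real_asymp
  \<comment> \<open>Here \<open>224 = 14 * 2 * 8\<close>, where the 2 comes from rounding up:
    \<open>N \<le> b r + 1 \<le> 2 * b r\<close>. The leading \<open>c\<close> cancels the
    \<open>1 / c\<close> of the rate, as the constant may depend on \<open>c\<close>.\<close>
  ultimately have "\<forall>\<^sub>F r in at_right 0. small_dev M (rescaled X c) r
      \<le> ereal (c * 224 / \<kappa> * (1 / c * (\<bar>ln r\<bar>\<^sup>2 / ln \<bar>ln r\<bar>)))"
    using small_dev_le_node_count[OF \<nu>0 c proc]
  proof eventually_elim
    case (elim r)
    have r: "0 < r" "ln r < 0" using elim by auto
    define N where "N = nat \<lceil>b r\<rceil>"
    have N: "b r \<le> N" "N \<le> b r + 1" using elim(4) unfolding N_def by linarith+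
    have N1: "1 \<le> N" using N(1) elim(4) by simp
    have "(36 * (1 / c) / real (N * 1) * (4 * real N / \<nu>) powr (1 / \<nu>)) ^ N \<le> r ^ 4"
    proof (rule power_le_fourth_power)
      have eq: "36 * (1 / c) / real (N * 1) * (4 * real N / \<nu>) powr (1 / \<nu>) = D * N powr (- \<kappa>)"
        using \<nu> N1 by (subst interpolation_rate) (auto simp: D_def \<kappa>_def)
      show "0 < 36 * (1 / c) / real (N * 1) * (4 * real N / \<nu>) powr (1 / \<nu>)"
        unfolding eq using D N1 by simp
      have "ln (b r) \<le> ln N" using N(1) elim(4) by simp
      then have "\<kappa> * ln (b r) - ln D \<le> \<kappa> * ln N - ln D" using \<kappa> by simp
      then have "b r * (\<kappa> * ln (b r) - ln D) \<le> N * (\<kappa> * ln N - ln D)"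
        using N(1) elim(4,5) by (intro mult_mono) auto
      also have "\<kappa> * ln N - ln D = - ln (D * N powr (- \<kappa>))"
        using D N1 by (simp add: ln_mult ln_powr)
      finally show "4 * (- ln r) \<le> N * (- ln (36 * (1 / c) / real (N * 1) * (4 * real N / \<nu>) powr (1 / \<nu>)))"
        unfolding eq using elim(1) by linarith
    qed (use r in auto)
    moreover have "real N \<le> 5 * (- ln r)" "real (N * 1) \<le> r powr (-1/2)"
      using N(2) elim(2,3) by auto
    ultimately have "small_dev M (rescaled X c) r \<le> ereal (14 * real (N * 1) * (- ln r))"
      using elim(8) N1 order_refl[of "1::nat"] by blast
    also have "14 * real (N * 1) * (- ln r) \<le> 14 * (2 * b r) * (- ln r)"
      using N(2) elim(4) r by (intro mult_right_mono mult_left_mono) auto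
    also have "\<dots> = c * 224 / \<kappa> * (1 / c * (\<bar>ln r\<bar>\<^sup>2 / ln \<bar>ln r\<bar>))"
      using r c \<kappa> by (simp add: b_def power2_eq_square field_simps)
    finally show ?case by simp
  qed
  moreover have "\<forall>\<^sub>F r in at_right 0. 0 < 1 / c * (\<bar>ln r\<bar>\<^sup>2 / ln \<bar>ln r\<bar>)"
    using c by real_asymp
  ultimately show ?thesis by (rule preceq0_I)
qed

lemma small_dev_rate_le_1:
  assumes \<nu>: "0 < \<nu>" "\<nu> \<le> 1" and c: "0 < c"
    and proc: "gaussian_process M X" "centered M X" "has_spectral_measure M X (spectral_F \<nu>)"
      "continuous_paths M X"
  shows "preceq0 (small_dev M (rescaled X c)) (\<lambda>r. 1 / c * \<bar>ln r\<bar> powr (1 + 1 / \<nu>))"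
proof -
  \<comment> \<open>The extra \<open>exp 1\<close> makes the base of the error at most
    \<open>1 / e\<close> once \<open>K \<ge> D * N powr (1 / \<nu> - 1)\<close>, so that
    \<open>N \<ge> 4 * (- ln r)\<close> already gives \<open>r ^ 4\<close>.\<close>
  define D where "D = 36 * (1 / c) * (4 / \<nu>) powr (1 / \<nu>) * exp 1"
  have D: "0 < D" using c \<nu> by (simp add: D_def)
  \<comment> \<open>The 1 accounts for rounding \<open>K\<close> up, since
    \<open>N \<le> N powr (1 / \<nu>)\<close> for \<nu> \<le> 1; the power of 5 comes from
    \<open>N \<le> 5 * (- ln r)\<close>.\<close>
  define E where "E = (D + 1) * 5 powr (1 / \<nu>)"
  have E: "0 < E" using D by (simp add: E_def)
  have "\<forall>\<^sub>F r in at_right 0. E * (- ln r) powr (1 / \<nu>) \<le> r powr (-1/2)"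
    using E \<nu> by real_asymp
  moreover have "\<forall>\<^sub>F r in at_right 0. 0 < r \<and> r < (1::real)"
    by (intro eventually_conj) (real_asymp+)
  moreover have "\<forall>\<^sub>F r in at_right (0::real). 1 \<le> - ln r" by real_asymp
  ultimately have "\<forall>\<^sub>F r in at_right 0. small_dev M (rescaled X c) r
      \<le> ereal (c * 14 * E * (1 / c * \<bar>ln r\<bar> powr (1 + 1 / \<nu>)))"
    using small_dev_le_node_count[OF \<nu>(1) c proc]
  proof eventually_elim
    case (elim r)
    have r: "0 < r" "ln r < 0" using elim by auto
    define N where "N = nat \<lceil>4 * (- ln r)\<rceil>"
    have N: "4 * (- ln r) \<le> N" "N \<le> 5 * (- ln r)" using elim(3) unfolding N_def by linarith+
    have N1: "1 \<le> N" using N(1) elim(3) by simp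
    define x where "x = D * real N powr (1 / \<nu> - 1)"
    have x: "0 < x" using D N1 by (simp add: x_def)
    define K where "K = nat \<lceil>x\<rceil>"
    have K: "x \<le> K" "K \<le> x + 1" using x unfolding K_def by linarith+
    have K1: "1 \<le> K" using x K(1) by linarith
    have "(36 * (1 / c) / real (N * K) * (4 * real N / \<nu>) powr (1 / \<nu>)) ^ N \<le> r ^ 4"
    proof (rule power_le_fourth_power)
      have eq: "36 * (1 / c) / real (N * K) * (4 * real N / \<nu>) powr (1 / \<nu>) = x / (exp 1 * K)"
        using \<nu> N1 K1 by (subst interpolation_rate) (auto simp: D_def x_def)
      show "0 < 36 * (1 / c) / real (N * K) * (4 * real N / \<nu>) powr (1 / \<nu>)"
        unfolding eq using x K1 by simp
      have "ln x \<le> ln K" using x K(1) by simp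
      then have "ln (x / (exp 1 * K)) \<le> - 1" using x K1 by (simp add: ln_div ln_mult)
      then have "real N * 1 \<le> real N * (- ln (x / (exp 1 * K)))" by (intro mult_left_mono) auto
      then show "4 * (- ln r) \<le> N * (- ln (36 * (1 / c) / real (N * K) * (4 * real N / \<nu>) powr (1 / \<nu>)))"
        unfolding eq using N(1) by linarith
    qed (use r in auto)
    moreover have NK: "real (N * K) \<le> E * (- ln r) powr (1 / \<nu>)"
    proof -
      have pw: "real N * real N powr (1 / \<nu> - 1) = real N powr (1 / \<nu>)"
        using N1 by (simp add: powr_diff)
      have "real N powr 1 \<le> real N powr (1 / \<nu>)" using N1 \<nu> by (intro powr_mono) auto
      then have NN: "real N \<le> real N powr (1 / \<nu>)" using N1 by simp
      have "real (N * K) \<le> N * (x + 1)" using K(2) by (simp add: mult_left_mono)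
      also have "\<dots> = D * (real N * real N powr (1 / \<nu> - 1)) + N" by (simp add: x_def algebra_simps)
      also have "\<dots> \<le> (D + 1) * real N powr (1 / \<nu>)" unfolding pw using NN by (simp add: algebra_simps)
      also have "\<dots> \<le> (D + 1) * (5 * (- ln r)) powr (1 / \<nu>)"
        using N(2) \<nu> D by (intro mult_left_mono powr_mono2) auto
      also have "\<dots> = E * (- ln r) powr (1 / \<nu>)"
        using powr_mult[of 5 "- ln r" "1 / \<nu>"] by (simp add: E_def)
      finally show ?thesis .
    qed
    moreover have "real (N * K) \<le> r powr (-1/2)" using NK elim(1) by linarith
    ultimately have "small_dev M (rescaled X c) r \<le> ereal (14 * real (N * K) * (- ln r))"
      using elim(4) N1 K1 N(2) by blast
    also have "14 * real (N * K) * (- ln r) \<le> 14 * (E * (- ln r) powr (1 / \<nu>)) * (- ln r)"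
      using NK r by (intro mult_right_mono mult_left_mono) auto
    also have "\<dots> = c * 14 * E * (1 / c * \<bar>ln r\<bar> powr (1 + 1 / \<nu>))"
      using r c by (simp add: powr_add)
    finally show ?case by simp
  qed
  moreover have "\<forall>\<^sub>F r in at_right 0. 0 < 1 / c * \<bar>ln r\<bar> powr (1 + 1 / \<nu>)"
    using c \<nu> by real_asymp
  ultimately show ?thesis by (rule preceq0_I)
qed

theorem theorem1p6:
  fixes M :: "'a measure" and X :: "real \<Rightarrow> 'a \<Rightarrow> real" and \<nu> c :: real
  assumes "0 < \<nu>"
    and "gaussian_process M X" and "centered M X" and "stationary M X"
    and "continuous_paths M X"
    and "has_spectral_measure M X (spectral_F \<nu>)"
    and "0 < c" and "c \<le> 1"
  shows "(1 < \<nu> \<longrightarrow>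
            preceq0 (small_dev M (rescaled X c))
              (\<lambda>r. 1 / c * (\<bar>ln r\<bar>\<^sup>2 / ln \<bar>ln r\<bar>)))
       \<and> (\<nu> \<le> 1 \<longrightarrow>
            preceq0 (small_dev M (rescaled X c))
              (\<lambda>r. 1 / c * \<bar>ln r\<bar> powr (1 + 1 / \<nu>)))"
  using assms small_dev_rate_gt_1 small_dev_rate_le_1 by blast

end
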